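(* Let $n\ge 0$, $d\ge 2$ be integers and let $T_1,T_2\in \mathrm{Sym}^d\mathbb{C}^{n+1}$. Then $\mathrm{sgr}(T_1\oplus T_2)=\mathrm{sgr}(T_1)+\mathrm{sgr}(T_2)$.
   Context: For $T=(t_{i_1,\dots,i_d})\in \mathrm{Sym}^d\mathbb{C}^{m+1}$ (coordinates with respect to the canonical basis), the associated homogeneous degree $d$ polynomial is $F(x)=\sum t_{i_1,\dots,i_d}x_{i_1}\cdots x_{i_d}\in\mathbb{C}[x_0,\dots,x_m]_d$. The symmetric geometric rank is $\mathrm{sgr}(T)=\mathrm{codim}\{x\in\mathbb{C}^{m+1} : \frac{\partial F}{\partial x_0}(x)=\cdots=\frac{\partial F}{\partial x_m}(x)=0\}$ (codimension in $\mathbb{C}^{m+1}$); equivalently, it is the codimension in $\mathbb{P}^m$ of the singular locus $\{[x]\in\mathbb{P}^m:\frac{\partial F}{\partial x_i}(x)=0\ \forall i\}$, with the convention that the empty set has codimension $m+1$ in $\mathbb{P}^m$. The direct sum $T_1\oplus T_2\in\mathrm{Sym}^d(\mathbb{C}^{n+1}\oplus\mathbb{C}^{n+1})$ is the block diagonal tensor with blocks $T_1,T_2$; if $F_1(x),F_2(y)$ are the polynomials associated to $T_1,T_2$ (in disjoint sets of variables $x$ and $y$), its associated polynomial is $F_1(x)+F_2(y)$. *)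

theory Defs
  imports "HOL-Analysis.Analysis" "HOL-Library.Extended_Nat" "HOL-Library.Multiset"
begin

section \<open>Symmetric tensors\<close>

text \<open>
  Coordinates of \<open>\<complex>\<^sup>m\<^sup>+\<^sup>1\<close> are indexed by a finite type with \<open>m + 1\<close> elements; types are nonempty,
  so every \<open>m \<ge> 0\<close> occurs.  A tensor of order \<open>d\<close> is given by its coordinates, a function on index
  tuples \<open>(i\<^sub>1, \<dots>, i\<^sub>d)\<close>, encoded as lists of length \<open>d\<close>.  The coordinate function is set to \<open>0\<close>
  on lists of other lengths, so that a tensor and its coordinate function determine each other.
\<close>

definition sym_tensors :: "nat \<Rightarrow> ('n::finite list \<Rightarrow> complex) set" where
  "sym_tensors d =
     {T. (\<forall>xs. length xs \<noteq> d \<longrightarrow> T xs = 0) \<and> (\<forall>xs ys. mset xs = mset ys \<longrightarrow> T xs = T ys)}"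

definition assoc_poly :: "nat \<Rightarrow> ('n::finite list \<Rightarrow> complex) \<Rightarrow> complex ^ 'n \<Rightarrow> complex" where
  "assoc_poly d T x = (\<Sum>xs | length xs = d. T xs * (\<Prod>i\<leftarrow>xs. x $ i))"

text \<open>The coordinates of \<open>\<complex>\<^sup>m\<^sup>+\<^sup>1 \<oplus> \<complex>\<^sup>n\<^sup>+\<^sup>1\<close> are indexed by the sum type.\<close>

definition tensor_sum ::
  "('m::finite list \<Rightarrow> complex) \<Rightarrow> ('n::finite list \<Rightarrow> complex) \<Rightarrow> ('m + 'n) list \<Rightarrow> complex"
  (infixl \<open>\<oplus>\<^sub>t\<close> 65) where
  "(S \<oplus>\<^sub>t T) zs =
     (if set zs \<subseteq> range Inl then S (map projl zs)
      else if set zs \<subseteq> range Inr then T (map projr zs)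
      else 0)"

lemma tensor_sum_sym_tensors:
  assumes "d > 0" "S \<in> sym_tensors d" "T \<in> sym_tensors d"
  shows "S \<oplus>\<^sub>t T \<in> sym_tensors d"
proof -
  have 1: "(S \<oplus>\<^sub>t T) zs = 0" if "length zs \<noteq> d" for zs
    using assms that by (auto simp: sym_tensors_def tensor_sum_def)
  have 2: "(S \<oplus>\<^sub>t T) xs = (S \<oplus>\<^sub>t T) ys" if eq: "mset xs = mset ys" for xs ys
  proof -
    have "set xs = set ys" using eq by (rule mset_eq_setD)
    moreover have "mset (map projl xs) = mset (map projl ys)"
      and "mset (map projr xs) = mset (map projr ys)"
      using eq by (simp_all add: mset_map)
    ultimately show ?thesis
      using assms(2,3) unfolding sym_tensors_def tensor_sum_def
      by (smt (verit, best) mem_Collect_eq)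
  qed
  show ?thesis using 1 2 unfolding sym_tensors_def by blast
qed

lemma assoc_poly_tensor_sum:
  fixes S :: "'a::finite list \<Rightarrow> complex" and T :: "'b::finite list \<Rightarrow> complex"
  assumes "d > 0"
  shows "assoc_poly d (S \<oplus>\<^sub>t T) z
    = assoc_poly d S (\<chi> i. z $ Inl i) + assoc_poly d T (\<chi> j. z $ Inr j)"
proof -
  define g where "g zs = (S \<oplus>\<^sub>t T) zs * (\<Prod>i\<leftarrow>zs. z $ i)" for zs
  define L :: "('a + 'b) list set" where "L = map Inl ` {xs. length xs = d}"
  define R :: "('a + 'b) list set" where "R = map Inr ` {ys. length ys = d}"
  have fina: "finite {xs :: 'a list. length xs = d}"
    using finite_lists_length_eq[of "UNIV :: 'a set" d] by simp
  have finb: "finite {xs :: 'b list. length xs = d}"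
    using finite_lists_length_eq[of "UNIV :: 'b set" d] by simp
  have finab: "finite {xs :: ('a + 'b) list. length xs = d}"
    using finite_lists_length_eq[of "UNIV :: ('a + 'b) set" d] by simp
  have inL: "zs \<in> L" if "length zs = d" "set zs \<subseteq> range Inl"
    for zs :: "('a + 'b) list"
  proof -
    have "zs = map Inl (map projl zs)" using that(2) by (induction zs) auto
    moreover have "map projl zs \<in> {xs. length xs = d}" using that(1) by simp
    ultimately show ?thesis unfolding L_def by (rule image_eqI)
  qed
  have inR: "zs \<in> R" if "length zs = d" "set zs \<subseteq> range Inr"
    for zs :: "('a + 'b) list"
  proof -
    have "zs = map Inr (map projr zs)" using that(2) by (induction zs) auto
    moreover have "map projr zs \<in> {xs. length xs = d}" using that(1) by simp
    ultimately show ?thesis unfolding R_def by (rule image_eqI)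
  qed
  have coordl: "map (($) (\<chi> i. z $ Inl i)) xs = map (\<lambda>i. z $ Inl i) xs" for xs
    by simp
  have coordr: "map (($) (\<chi> j. z $ Inr j)) ys = map (\<lambda>j. z $ Inr j) ys" for ys
    by simp
  have disj: "L \<inter> R = {}"
  proof -
    have False if "length xs = d" "map Inl xs = map Inr ys" for xs :: "'a list" and ys :: "'b list"
      using that assms by (cases xs; cases ys) auto
    then show ?thesis unfolding L_def R_def by blast
  qed
  have "assoc_poly d (S \<oplus>\<^sub>t T) z = sum g {zs. length zs = d}"
    by (simp add: assoc_poly_def g_def)
  also have "\<dots> = sum g (L \<union> R)"
  proof (rule sum.mono_neutral_right[OF finab])
    show "L \<union> R \<subseteq> {zs. length zs = d}" by (auto simp: L_def R_def)
    show "\<forall>zs\<in>{zs. length zs = d} - (L \<union> R). g zs = 0"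
      using inL inR by (auto simp: g_def tensor_sum_def)
  qed
  also have "\<dots> = sum g L + sum g R"
    using fina finb disj by (intro sum.union_disjoint) (auto simp: L_def R_def)
  also have "sum g L = assoc_poly d S (\<chi> i. z $ Inl i)"
  proof -
    have "sum g L = (\<Sum>xs | length xs = d. g (map Inl xs))"
      unfolding L_def by (subst sum.reindex) (auto simp: inj_on_def inj_map_eq_map)
    also have "\<dots> = assoc_poly d S (\<chi> i. z $ Inl i)"
      unfolding assoc_poly_def
      by (intro sum.cong) (auto simp: g_def tensor_sum_def o_def image_subset_iff coordl)
    finally show ?thesis .
  qed
  also have "sum g R = assoc_poly d T (\<chi> j. z $ Inr j)"
  proof -
    have "sum g R = (\<Sum>ys | length ys = d. g (map Inr ys))"
      unfolding R_def by (subst sum.reindex) (auto simp: inj_on_def inj_map_eq_map)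
    also have "\<dots> = assoc_poly d T (\<chi> j. z $ Inr j)"
      unfolding assoc_poly_def
    proof (intro sum.cong refl)
      fix ys :: "'b list" assume "ys \<in> {ys. length ys = d}"
      then have "\<not> set (map Inr ys :: ('a + 'b) list) \<subseteq> range Inl"
        using assms by (cases ys) auto
      then show "g (map Inr ys) = T ys * (\<Prod>j\<leftarrow>ys. (\<chi> j. z $ Inr j) $ j)"
        by (auto simp: g_def tensor_sum_def o_def image_subset_iff coordr)
    qed
    finally show ?thesis .
  qed
  finally show ?thesis .
qed


section \<open>Dimension of affine algebraic sets\<close>

inductive polynomial_fun :: "(complex ^ 'n \<Rightarrow> complex) \<Rightarrow> bool" where
  const: "polynomial_fun (\<lambda>x. c)"
| coord: "polynomial_fun (\<lambda>x. x $ i)"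
| add: "polynomial_fun f \<Longrightarrow> polynomial_fun g \<Longrightarrow> polynomial_fun (\<lambda>x. f x + g x)"
| mult: "polynomial_fun f \<Longrightarrow> polynomial_fun g \<Longrightarrow> polynomial_fun (\<lambda>x. f x * g x)"

definition zariski_closed :: "(complex ^ 'n) set \<Rightarrow> bool" where
  "zariski_closed X \<longleftrightarrow> (\<exists>P. (\<forall>p\<in>P. polynomial_fun p) \<and> X = {x. \<forall>p\<in>P. p x = 0})"

definition zariski_irreducible :: "(complex ^ 'n) set \<Rightarrow> bool" where
  "zariski_irreducible X \<longleftrightarrow> X \<noteq> {} \<and>
     (\<forall>A B. zariski_closed A \<longrightarrow> zariski_closed B \<longrightarrow> X \<subseteq> A \<union> B \<longrightarrow> X \<subseteq> A \<or> X \<subseteq> B)"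

text \<open>
  The Krull dimension of a Zariski closed set: the supremum of the lengths \<open>k\<close> of the chains
  \<open>Z\<^sub>0 \<subset> Z\<^sub>1 \<subset> \<dots> \<subset> Z\<^sub>k\<close> of irreducible closed subsets.  For the empty set the supremum over
  the empty set of chains is \<open>0\<close>, so this is meaningful for nonempty \<open>X\<close> only.
\<close>

definition alg_dim :: "(complex ^ 'n) set \<Rightarrow> enat" where
  "alg_dim X = Sup {enat k | k. \<exists>Z :: nat \<Rightarrow> (complex ^ 'n) set.
     (\<forall>i\<le>k. zariski_closed (Z i) \<and> zariski_irreducible (Z i) \<and> Z i \<subseteq> X) \<and>
     (\<forall>i<k. Z i \<subset> Z (Suc i))}"

definition alg_codim :: "(complex ^ 'n::finite) set \<Rightarrow> enat" where
  "alg_codim X = enat CARD('n) - alg_dim X"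


section \<open>Symmetric geometric rank\<close>

definition partial_deriv :: "'n \<Rightarrow> (complex ^ 'n \<Rightarrow> complex) \<Rightarrow> complex ^ 'n \<Rightarrow> complex" where
  "partial_deriv i F x = deriv (\<lambda>z. F (\<chi> j. if j = i then z else x $ j)) (x $ i)"

text \<open>
  For \<open>d \<ge> 2\<close> the singular locus contains \<open>0\<close>, hence is nonempty.
\<close>

definition sgr :: "nat \<Rightarrow> ('n::finite list \<Rightarrow> complex) \<Rightarrow> enat" where
  "sgr d T = alg_codim {x. \<forall>i. partial_deriv i (assoc_poly d T) x = 0}"

end

theory Submission
  imports Defs "HOL-Library.Function_Algebras" "HOL-Computational_Algebra.Fundamental_Theorem_Algebra"
begin

text \<open>
  The partial derivatives of \<open>F\<^sub>1(x) + F\<^sub>2(y)\<close> are those of \<open>F\<^sub>1\<close> in \<open>x\<close> and those of \<open>F\<^sub>2\<close> in \<open>y\<close>, so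
  the singular locus of the direct sum is the product of the two singular loci
  (\<open>singular_locus_tensor_sum\<close>).  These are Zariski closed, are invariant under scaling, and contain
  the origin since \<open>d \<ge> 2\<close>.  What remains is the additivity of the Krull dimension for products of
  such cones \<open>X\<close> (\<open>alg_codim_vec_product\<close>), together with the bound of the dimension by the number
  of coordinates, which keeps the subtraction in the codimension from being truncated.

  For a cone, the dimension can be certified from both sides by the same number \<open>r\<close>.

  From above: if \<open>r\<close> linear forms have only the origin as a common zero on \<open>X\<close>, then no chain of
  irreducible closed subsets of \<open>X\<close> is longer than \<open>r\<close> (\<open>irreducible_chain_le_forms\<close>).  By the
  Nullstellensatz a power of each coordinate lies, on \<open>X\<close>, in the ideal generated by the forms; by
  homogeneity the degrees are under control, and so the polynomial functions of degree at most \<open>s\<close>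
  restrict to a space of dimension \<open>O(s\<^sup>r)\<close> on \<open>X\<close> (\<open>cone_finite_over_forms\<close>).  A chain of length \<open>k\<close>
  gives \<open>k\<close> algebraically independent functions on \<open>X\<close>, hence growth at least of order \<open>s\<^sup>k\<close>.  The
  Nullstellensatz is obtained from the uncountability of \<open>\<complex>\<close> (\<open>maximal_avoiding_coord\<close>).

  From below: for some \<open>r\<close> there are \<open>r\<close> such forms and also a chain of length \<open>r\<close>
  (\<open>cone_forms_and_chain\<close>).  One cuts \<open>X\<close> successively by hyperplanes that contain none of the
  irreducible components, except possibly the origin, until only the origin is left.  Each cut
  provides one form and one further member of the chain.  Hilbert's basis theorem ensures that there
  are finitely many components and that the process terminates.

  Both certificates pass to products: the forms on the two factors together have only the origin as
  a common zero, and two chains are concatenated to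
  \<open>Z\<^sub>0 \<times> W\<^sub>0 \<subset> \<dots> \<subset> Z\<^sub>r \<times> W\<^sub>0 \<subset> \<dots> \<subset> Z\<^sub>r \<times> W\<^sub>q\<close>, whose members are irreducible because products of
  irreducible sets are irreducible (\<open>zariski_irreducible_vec_product\<close>).
\<close>

section \<open>Counting in spaces of functions\<close>

lemma underdetermined_system:
  fixes c :: "'a \<Rightarrow> 'b \<Rightarrow> 'f::field"
  assumes "finite B" "finite A" "card B < card A"
  shows "\<exists>d. (\<exists>a\<in>A. d a \<noteq> 0) \<and> (\<forall>b\<in>B. (\<Sum>a\<in>A. d a * c a b) = 0)"
  using assms
proof (induction B arbitrary: A c rule: finite_induct)
  case empty
  then have "\<exists>a. a \<in> A" by (auto simp: card_gt_0_iff)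
  then show ?case by (intro exI[of _ "\<lambda>_. 1"]) auto
next
  case (insert b B)
  show ?case
  proof (cases "\<forall>a\<in>A. c a b = 0")
    case True
    have "card B < card A" using insert by simp
    from insert.IH[OF insert.prems(1) this, of c] True show ?thesis by auto
  next
    case False
    then obtain p where p: "p \<in> A" "c p b \<noteq> 0" by blast
    let ?A = "A - {p}"
    define c' where "c' a b' = c a b' - c a b / c p b * c p b'" for a b'
    have "finite ?A" "card B < card ?A" using insert p by auto
    from insert.IH[OF this, of c'] obtain d where d: "\<exists>a\<in>?A. d a \<noteq> 0"
      "\<forall>b'\<in>B. (\<Sum>a\<in>?A. d a * c' a b') = 0" by blast
    define t where "t = - (\<Sum>a\<in>?A. d a * c a b) / c p b"
    define e where "e = d(p := t)"
    have split: "(\<Sum>a\<in>A. e a * c a b') = t * c p b' + (\<Sum>a\<in>?A. d a * c a b')" for b'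
      using insert.prems(1) p(1) by (subst sum.remove[of A p]) (auto simp: e_def intro!: sum.cong)
    have "(\<Sum>a\<in>A. e a * c a b') = (\<Sum>a\<in>?A. d a * c' a b')" for b'
      unfolding split t_def c'_def
      by (simp add: right_diff_distrib sum_subtractf sum_distrib_right sum_divide_distrib mult.assoc)
    moreover have "(\<Sum>a\<in>A. e a * c a b) = 0"
      unfolding split t_def using p by simp
    ultimately have "\<forall>b'\<in>insert b B. (\<Sum>a\<in>A. e a * c a b') = 0" using d(2) by auto
    moreover have "\<exists>a\<in>A. e a \<noteq> 0" using d(1) by (auto simp: e_def)
    ultimately show ?thesis by blast
  qed
qed

text \<open>Functions are compared on a set \<open>X\<close> only: for a Zariski closed set \<open>X\<close>, this is the
  arithmetic of its coordinate ring, without quotients.\<close>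

definition span_on :: "'x set \<Rightarrow> ('b \<Rightarrow> 'x \<Rightarrow> complex) \<Rightarrow> 'b set \<Rightarrow> ('x \<Rightarrow> complex) \<Rightarrow> bool" where
  "span_on X u B f \<longleftrightarrow> (\<exists>c. \<forall>x\<in>X. f x = (\<Sum>b\<in>B. c b * u b x))"

lemma span_on_zero: "span_on X u B (\<lambda>x. 0)"
  unfolding span_on_def by (intro exI[of _ "\<lambda>_. 0"]) simp

lemma span_on_add: "span_on X u B f \<Longrightarrow> span_on X u B g \<Longrightarrow> span_on X u B (\<lambda>x. f x + g x)"
  unfolding span_on_def
proof clarify
  fix c d
  assume "\<forall>x\<in>X. f x = (\<Sum>b\<in>B. c b * u b x)" "\<forall>x\<in>X. g x = (\<Sum>b\<in>B. d b * u b x)"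
  then show "\<exists>c. \<forall>x\<in>X. f x + g x = (\<Sum>b\<in>B. c b * u b x)"
    by (intro exI[of _ "\<lambda>b. c b + d b"]) (simp add: distrib_right sum.distrib)
qed

lemma span_on_scale: "span_on X u B f \<Longrightarrow> span_on X u B (\<lambda>x. a * f x)"
  unfolding span_on_def
proof clarify
  fix c
  assume "\<forall>x\<in>X. f x = (\<Sum>b\<in>B. c b * u b x)"
  then show "\<exists>c. \<forall>x\<in>X. a * f x = (\<Sum>b\<in>B. c b * u b x)"
    by (intro exI[of _ "\<lambda>b. a * c b"]) (simp add: sum_distrib_left mult.assoc)
qed

lemma span_on_sum:
  assumes "\<And>i. i \<in> I \<Longrightarrow> span_on X u B (f i)"
  shows "span_on X u B (\<lambda>x. \<Sum>i\<in>I. f i x)"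
  using assms by (induction I rule: infinite_finite_induct) (auto intro: span_on_zero span_on_add)

lemma span_on_base:
  assumes "finite B" "b \<in> B"
  shows "span_on X u B (u b)"
  unfolding span_on_def
  using assms by (intro exI[of _ "\<lambda>b'. if b' = b then 1 else 0"]) (simp add: if_distrib[of "\<lambda>c. c * _"] cong: if_cong)

lemma span_on_cong:
  assumes "span_on X u B f" "\<And>x. x \<in> X \<Longrightarrow> g x = f x"
  shows "span_on X u B g"
  using assms unfolding span_on_def by simp

lemma span_on_subset: "span_on Y u B f \<Longrightarrow> X \<subseteq> Y \<Longrightarrow> span_on X u B f"
  unfolding span_on_def by blast

lemma span_on_trans:
  assumes f: "span_on X u B f" and u: "\<And>b. b \<in> B \<Longrightarrow> span_on X v C (u b)"
  shows "span_on X v C f"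
proof -
  obtain c where c: "\<forall>x\<in>X. f x = (\<Sum>b\<in>B. c b * u b x)" using f unfolding span_on_def by blast
  have "span_on X v C (\<lambda>x. \<Sum>b\<in>B. c b * u b x)"
    by (intro span_on_sum span_on_scale u)
  then show ?thesis by (rule span_on_cong) (use c in simp)
qed

lemma span_on_mult:
  assumes f: "span_on X u B f" and g: "span_on X v C g"
    and uv: "\<And>b c. b \<in> B \<Longrightarrow> c \<in> C \<Longrightarrow> span_on X w D (\<lambda>x. u b x * v c x)"
  shows "span_on X w D (\<lambda>x. f x * g x)"
proof -
  obtain p where p: "\<forall>x\<in>X. f x = (\<Sum>b\<in>B. p b * u b x)" using f unfolding span_on_def by blast
  obtain q where q: "\<forall>x\<in>X. g x = (\<Sum>c\<in>C. q c * v c x)" using g unfolding span_on_def by blast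
  have "span_on X w D (\<lambda>x. \<Sum>b\<in>B. \<Sum>c\<in>C. (p b * q c) * (u b x * v c x))"
    by (intro span_on_sum span_on_scale uv)
  then show ?thesis
    by (rule span_on_cong) (simp add: p q sum_product mult_ac)
qed

lemma span_on_dependent:
  assumes "finite B" "finite A" "card B < card A" and g: "\<And>a. a \<in> A \<Longrightarrow> span_on X u B (g a)"
  shows "\<exists>d. (\<exists>a\<in>A. d a \<noteq> 0) \<and> (\<forall>x\<in>X. (\<Sum>a\<in>A. d a * g a x) = 0)"
proof -
  have "\<forall>a\<in>A. \<exists>c. \<forall>x\<in>X. g a x = (\<Sum>b\<in>B. c b * u b x)" using g unfolding span_on_def by blast
  then obtain c where c: "\<And>a x. a \<in> A \<Longrightarrow> x \<in> X \<Longrightarrow> g a x = (\<Sum>b\<in>B. c a b * u b x)" by metis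
  obtain d where d: "\<exists>a\<in>A. d a \<noteq> 0" "\<And>b. b \<in> B \<Longrightarrow> (\<Sum>a\<in>A. d a * c a b) = 0"
    using underdetermined_system[OF assms(1-3), of c] by blast
  have "(\<Sum>a\<in>A. d a * g a x) = 0" if x: "x \<in> X" for x
  proof -
    have "(\<Sum>a\<in>A. d a * g a x) = (\<Sum>a\<in>A. \<Sum>b\<in>B. d a * c a b * u b x)"
      by (intro sum.cong refl) (simp add: c[OF _ x] sum_distrib_left mult.assoc)
    also have "\<dots> = (\<Sum>b\<in>B. (\<Sum>a\<in>A. d a * c a b) * u b x)"
      by (subst sum.swap) (simp add: sum_distrib_right)
    also have "\<dots> = 0" by (simp add: d(2))
    finally show ?thesis .
  qed
  then show ?thesis using d(1) by blast
qed


section \<open>Polynomial functions, monomials and degrees\<close>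

lemma polynomial_fun_uminus: "polynomial_fun f \<Longrightarrow> polynomial_fun (\<lambda>x. - f x)"
  using polynomial_fun.mult[OF polynomial_fun.const[of "-1"], of f] by simp

lemma polynomial_fun_diff: "polynomial_fun f \<Longrightarrow> polynomial_fun g \<Longrightarrow> polynomial_fun (\<lambda>x. f x - g x)"
  using polynomial_fun.add[OF _ polynomial_fun_uminus, of f g] by simp

lemma polynomial_fun_sum:
  "(\<And>i. i \<in> I \<Longrightarrow> polynomial_fun (f i)) \<Longrightarrow> polynomial_fun (\<lambda>x. \<Sum>i\<in>I. f i x)"
  by (induction I rule: infinite_finite_induct) (auto intro: polynomial_fun.intros)

lemma polynomial_fun_prod:
  "(\<And>i. i \<in> I \<Longrightarrow> polynomial_fun (f i)) \<Longrightarrow> polynomial_fun (\<lambda>x. \<Prod>i\<in>I. f i x)"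
  by (induction I rule: infinite_finite_induct) (auto intro: polynomial_fun.intros)

lemma polynomial_fun_power: "polynomial_fun f \<Longrightarrow> polynomial_fun (\<lambda>x. f x ^ k)"
  by (induction k) (auto intro: polynomial_fun.intros)

lemmas polynomial_fun_intros = polynomial_fun.intros polynomial_fun_uminus polynomial_fun_diff
  polynomial_fun_sum polynomial_fun_prod polynomial_fun_power

lemma polynomial_fun_compose:
  fixes \<phi> :: "complex ^ 'm \<Rightarrow> complex ^ 'n"
  assumes "polynomial_fun f" "\<And>i. polynomial_fun (\<lambda>x. \<phi> x $ i)"
  shows "polynomial_fun (\<lambda>x. f (\<phi> x))"
  using assms by (induction rule: polynomial_fun.induct) (auto intro: polynomial_fun.intros)

text \<open>A monomial is given by the list of its variables, with repetitions; lists of equal multisets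
  give the same monomial.\<close>

definition monom_fun :: "'n list \<Rightarrow> complex ^ 'n \<Rightarrow> complex" where
  "monom_fun is x = (\<Prod>i\<leftarrow>is. x $ i)"

lemma monom_fun_append: "monom_fun (is @ js) x = monom_fun is x * monom_fun js x"
  by (simp add: monom_fun_def)

lemma monom_fun_replicate: "monom_fun (replicate k i) x = (x $ i) ^ k"
  by (simp add: monom_fun_def)

lemma monom_fun_mset: "mset is = mset js \<Longrightarrow> monom_fun is x = monom_fun js x"
  unfolding monom_fun_def by (metis mset_map prod_mset_prod_list)

lemma monom_fun_scale: "monom_fun is (t *s x) = t ^ length is * monom_fun is x"
  by (induction "is") (auto simp: monom_fun_def)

lemma polynomial_fun_monom: "polynomial_fun (monom_fun is)"
proof (induction "is")
  case Nil
  then show ?case by (simp add: monom_fun_def[abs_def] polynomial_fun.const)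
next
  case (Cons i "is")
  then show ?case using polynomial_fun.mult[OF polynomial_fun.coord[of i]]
    by (simp add: monom_fun_def[abs_def])
qed

definition lists_upto :: "nat \<Rightarrow> 'n::finite list set" where
  "lists_upto s = {is. length is \<le> s}"

lemma finite_lists_upto [simp]: "finite (lists_upto s)"
  using finite_lists_length_le[of "UNIV :: 'a set" s] by (simp add: lists_upto_def)

definition degree_le :: "nat \<Rightarrow> (complex ^ 'n \<Rightarrow> complex) \<Rightarrow> bool" where
  "degree_le s f \<longleftrightarrow> span_on UNIV monom_fun (lists_upto s) f"

lemma degree_le_monom: "length is \<le> s \<Longrightarrow> degree_le s (monom_fun is)"
  unfolding degree_le_def by (rule span_on_base[OF finite_lists_upto]) (simp add: lists_upto_def)

lemma degree_le_const: "degree_le s (\<lambda>x. c)"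
  using span_on_scale[OF degree_le_monom[of "[]" s, unfolded degree_le_def], of c]
  by (simp add: degree_le_def monom_fun_def)

lemma degree_le_mono: "degree_le s f \<Longrightarrow> s \<le> t \<Longrightarrow> degree_le t f"
  unfolding degree_le_def
  by (erule span_on_trans) (auto simp: lists_upto_def intro!: degree_le_monom[unfolded degree_le_def lists_upto_def])

lemma degree_le_mult:
  assumes "degree_le s f" "degree_le t g"
  shows "degree_le (s + t) (\<lambda>x. f x * g x)"
  using assms unfolding degree_le_def
proof (rule span_on_mult)
  fix ms js :: "'a list" assume "ms \<in> lists_upto s" "js \<in> lists_upto t"
  then have "degree_le (s + t) (monom_fun (ms @ js))"
    by (intro degree_le_monom) (auto simp: lists_upto_def)
  then show "span_on UNIV monom_fun (lists_upto (s + t)) (\<lambda>x. monom_fun ms x * monom_fun js x)"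
    by (simp add: degree_le_def monom_fun_append[abs_def])
qed

lemma degree_le_power: "degree_le s f \<Longrightarrow> degree_le (s * k) (\<lambda>x. f x ^ k)"
  by (induction k) (auto intro: degree_le_const degree_le_mult)

lemma degree_le_prod:
  assumes "finite I" "\<And>i. i \<in> I \<Longrightarrow> degree_le s (f i)"
  shows "degree_le (card I * s) (\<lambda>x. \<Prod>i\<in>I. f i x)"
  using assms by (induction I) (auto intro: degree_le_const degree_le_mult)

lemma polynomial_fun_degree:
  assumes "polynomial_fun f"
  shows "\<exists>s. degree_le s f"
  using assms
proof (induction rule: polynomial_fun.induct)
  case (const c)
  then show ?case using degree_le_const by blast
next
  case (coord i)
  have "monom_fun [i] = (\<lambda>x. x $ i)" by (simp add: monom_fun_def fun_eq_iff)
  then show ?case using degree_le_monom[of "[i]" 1] by auto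
next
  case (add f g)
  then obtain s t where "degree_le s f" "degree_le t g" by blast
  then have "degree_le (max s t) f" "degree_le (max s t) g" by (auto intro: degree_le_mono)
  then show ?case unfolding degree_le_def using span_on_add by blast
next
  case (mult f g)
  then show ?case using degree_le_mult by blast
qed

section \<open>The Nullstellensatz\<close>

definition poly_ideal :: "(complex ^ 'n \<Rightarrow> complex) set \<Rightarrow> bool" where
  "poly_ideal J \<longleftrightarrow> J \<subseteq> Collect polynomial_fun \<and> (\<lambda>x. 0) \<in> J \<and>
     (\<forall>f\<in>J. \<forall>g\<in>J. (\<lambda>x. f x + g x) \<in> J) \<and>
     (\<forall>f\<in>J. \<forall>h. polynomial_fun h \<longrightarrow> (\<lambda>x. h x * f x) \<in> J)"

context
  fixes J :: "(complex ^ 'n \<Rightarrow> complex) set"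
  assumes J: "poly_ideal J"
begin

lemma poly_ideal_polynomial: "f \<in> J \<Longrightarrow> polynomial_fun f"
  using J unfolding poly_ideal_def by blast

lemma poly_ideal_zero: "(\<lambda>x. 0) \<in> J"
  using J unfolding poly_ideal_def by blast

lemma poly_ideal_add: "f \<in> J \<Longrightarrow> g \<in> J \<Longrightarrow> (\<lambda>x. f x + g x) \<in> J"
  using J unfolding poly_ideal_def by blast

lemma poly_ideal_mult: "f \<in> J \<Longrightarrow> polynomial_fun h \<Longrightarrow> (\<lambda>x. h x * f x) \<in> J"
  using J unfolding poly_ideal_def by blast

lemma poly_ideal_diff: "f \<in> J \<Longrightarrow> g \<in> J \<Longrightarrow> (\<lambda>x. f x - g x) \<in> J"
  using poly_ideal_add[of f "\<lambda>x. - 1 * g x"] poly_ideal_mult[of g "\<lambda>x. - 1", OF _ polynomial_fun.const]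
  by simp

lemma poly_ideal_sum:
  "(\<And>i. i \<in> I \<Longrightarrow> f i \<in> J) \<Longrightarrow> (\<lambda>x. \<Sum>i\<in>I. f i x) \<in> J"
  by (induction I rule: infinite_finite_induct) (auto intro: poly_ideal_zero poly_ideal_add)

end

lemma poly_ideal_adjoin:
  assumes M: "poly_ideal M" and u: "polynomial_fun u"
  shows "poly_ideal {(\<lambda>x. m x + p x * u x) | m p. m \<in> M \<and> polynomial_fun p}" (is "poly_ideal ?I")
  unfolding poly_ideal_def
proof (intro conjI ballI allI impI)
  show "?I \<subseteq> Collect polynomial_fun"
    using poly_ideal_polynomial[OF M] u by (auto intro!: polynomial_fun_intros)
  show "(\<lambda>x. 0) \<in> ?I"
    using poly_ideal_zero[OF M] polynomial_fun.const[of 0] by (force intro: exI[of _ "\<lambda>x. 0"])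
next
  fix f g assume "f \<in> ?I" "g \<in> ?I"
  then obtain m p m' p' where *: "f = (\<lambda>x. m x + p x * u x)" "g = (\<lambda>x. m' x + p' x * u x)"
    "m \<in> M" "m' \<in> M" "polynomial_fun p" "polynomial_fun p'" by blast
  then have "(\<lambda>x. f x + g x) = (\<lambda>x. (m x + m' x) + (p x + p' x) * u x)"
    by (simp add: algebra_simps)
  moreover have "(\<lambda>x. m x + m' x) \<in> M" "polynomial_fun (\<lambda>x. p x + p' x)"
    using * poly_ideal_add[OF M] polynomial_fun.add by auto
  ultimately show "(\<lambda>x. f x + g x) \<in> ?I"
    by (intro CollectI exI[of _ "\<lambda>x. m x + m' x"] exI[of _ "\<lambda>x. p x + p' x"]) simp
next
  fix f h :: "complex ^ 'a \<Rightarrow> complex"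
  assume "f \<in> ?I" "polynomial_fun h"
  then obtain m p where *: "f = (\<lambda>x. m x + p x * u x)" "m \<in> M" "polynomial_fun p" by blast
  then have "(\<lambda>x. h x * f x) = (\<lambda>x. h x * m x + (h x * p x) * u x)"
    by (simp add: algebra_simps)
  moreover have "(\<lambda>x. h x * m x) \<in> M" "polynomial_fun (\<lambda>x. h x * p x)"
    using * \<open>polynomial_fun h\<close> poly_ideal_mult[OF M] polynomial_fun.mult by auto
  ultimately show "(\<lambda>x. h x * f x) \<in> ?I"
    by (intro CollectI exI[of _ "\<lambda>x. h x * m x"] exI[of _ "\<lambda>x. h x * p x"]) simp
qed

lemma poly_ideal_Union_chain:
  assumes "\<C> \<noteq> {}" "\<And>I. I \<in> \<C> \<Longrightarrow> poly_ideal I" "\<And>I I'. I \<in> \<C> \<Longrightarrow> I' \<in> \<C> \<Longrightarrow> I \<subseteq> I' \<or> I' \<subseteq> I"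
  shows "poly_ideal (\<Union>\<C>)"
  unfolding poly_ideal_def
proof (intro conjI ballI allI impI)
  show "\<Union>\<C> \<subseteq> Collect polynomial_fun" "(\<lambda>x. 0) \<in> \<Union>\<C>"
    using assms(1,2) poly_ideal_polynomial poly_ideal_zero by blast+
next
  fix f g assume "f \<in> \<Union>\<C>" "g \<in> \<Union>\<C>"
  then obtain I where "I \<in> \<C>" "f \<in> I" "g \<in> I" using assms(3) by blast
  then show "(\<lambda>x. f x + g x) \<in> \<Union>\<C>" using assms(2) poly_ideal_add by blast
next
  fix f h :: "complex ^ 'a \<Rightarrow> complex"
  assume "f \<in> \<Union>\<C>" "polynomial_fun h"
  then show "(\<lambda>x. h x * f x) \<in> \<Union>\<C>" using assms(2) poly_ideal_mult by blast
qed

text \<open>Ideals that contain no power of \<open>f\<close> correspond to the proper ideals after inverting \<open>f\<close>.  This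
  form avoids rings of fractions.\<close>

definition avoids_powers :: "(complex ^ 'n \<Rightarrow> complex) \<Rightarrow> (complex ^ 'n \<Rightarrow> complex) set \<Rightarrow> bool" where
  "avoids_powers f M \<longleftrightarrow> (\<forall>k. (\<lambda>x. f x ^ k) \<notin> M)"

lemma exists_maximal_avoiding_ideal:
  assumes "poly_ideal J" "avoids_powers f J"
  shows "\<exists>M. poly_ideal M \<and> J \<subseteq> M \<and> avoids_powers f M \<and>
    (\<forall>I. poly_ideal I \<longrightarrow> M \<subseteq> I \<longrightarrow> avoids_powers f I \<longrightarrow> I = M)"
proof -
  define \<A> where "\<A> = {I. poly_ideal I \<and> J \<subseteq> I \<and> avoids_powers f I}"
  have "\<exists>M\<in>\<A>. \<forall>I\<in>\<A>. M \<subseteq> I \<longrightarrow> I = M"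
  proof (rule subset_Zorn_nonempty)
    show "\<A> \<noteq> {}" using assms by (auto simp: \<A>_def)
    fix \<C> assume "\<C> \<noteq> {}" and chain: "subset.chain \<A> \<C>"
    have \<C>: "\<C> \<subseteq> \<A>" and lin: "\<And>I I'. I \<in> \<C> \<Longrightarrow> I' \<in> \<C> \<Longrightarrow> I \<subseteq> I' \<or> I' \<subseteq> I"
      using chain by (auto simp: subset_chain_def)
    have "poly_ideal (\<Union>\<C>)"
      using \<open>\<C> \<noteq> {}\<close> _ lin by (rule poly_ideal_Union_chain) (use \<C> in \<open>auto simp: \<A>_def\<close>)
    then show "\<Union>\<C> \<in> \<A>"
      using \<C> \<open>\<C> \<noteq> {}\<close> by (fastforce simp: \<A>_def avoids_powers_def)
  qed
  then obtain M where M: "M \<in> \<A>" "\<And>I. I \<in> \<A> \<Longrightarrow> M \<subseteq> I \<Longrightarrow> I = M" by blast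
  then show ?thesis by (intro exI[of _ M]) (auto simp: \<A>_def)
qed

context
  fixes f :: "complex ^ 'n \<Rightarrow> complex" and M :: "(complex ^ 'n \<Rightarrow> complex) set"
  assumes M: "poly_ideal M" and avoids: "avoids_powers f M"
    and maximal: "\<forall>I. poly_ideal I \<longrightarrow> M \<subseteq> I \<longrightarrow> avoids_powers f I \<longrightarrow> I = M"
begin

text \<open>The ideal generated by \<open>M\<close> and \<open>u\<close> is larger than \<open>M\<close>, so it contains a power of \<open>f\<close>:
  after inverting \<open>f\<close>, every element outside \<open>M\<close> is a unit modulo \<open>M\<close>.\<close>

lemma maximal_avoiding_unit:
  assumes u: "polynomial_fun u" "u \<notin> M"
  shows "\<exists>k m p. m \<in> M \<and> polynomial_fun p \<and> (\<lambda>x. f x ^ k) = (\<lambda>x. m x + p x * u x)"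
proof -
  let ?I = "{(\<lambda>x. m x + p x * u x) | m p. m \<in> M \<and> polynomial_fun p}"
  have "M \<subseteq> ?I"
  proof
    fix m assume "m \<in> M"
    then show "m \<in> ?I" by (intro CollectI exI[of _ m] exI[of _ "\<lambda>x. 0"]) (auto intro: polynomial_fun.const)
  qed
  moreover have "u \<in> ?I"
    using poly_ideal_zero[OF M] by (intro CollectI exI[of _ "\<lambda>x. 0"] exI[of _ "\<lambda>x. 1"]) (auto intro: polynomial_fun.const)
  ultimately have "\<not> avoids_powers f ?I"
    using maximal poly_ideal_adjoin[OF M u(1)] u(2) by blast
  then show ?thesis unfolding avoids_powers_def by blast
qed

lemma maximal_avoiding_prime:
  assumes u: "polynomial_fun u" "u \<notin> M" and v: "polynomial_fun v" "v \<notin> M"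
  shows "(\<lambda>x. u x * v x) \<notin> M"
proof
  assume uv: "(\<lambda>x. u x * v x) \<in> M"
  obtain k m p where k: "m \<in> M" "polynomial_fun p" "(\<lambda>x. f x ^ k) = (\<lambda>x. m x + p x * u x)"
    using maximal_avoiding_unit[OF u] by blast
  obtain l m' q where l: "m' \<in> M" "polynomial_fun q" "(\<lambda>x. f x ^ l) = (\<lambda>x. m' x + q x * v x)"
    using maximal_avoiding_unit[OF v] by blast
  have "(\<lambda>x. f x ^ (k + l)) = (\<lambda>x. f x ^ k * f x ^ l)" by (simp add: power_add)
  also have "\<dots> = (\<lambda>x. ((m' x + q x * v x) * m x + (p x * u x) * m' x) + (p x * q x) * (u x * v x))"
    using k(3) l(3) by (simp add: fun_eq_iff algebra_simps)
  also have "\<dots> \<in> M"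
    by (intro poly_ideal_add[OF M] poly_ideal_mult[OF M] polynomial_fun_intros k l uv u v
        poly_ideal_polynomial[OF M])
  finally show False using avoids unfolding avoids_powers_def by blast
qed

lemma maximal_avoiding_not_const:
  assumes "c \<noteq> 0"
  shows "(\<lambda>x. c) \<notin> M"
proof
  assume "(\<lambda>x. c) \<in> M"
  from poly_ideal_mult[OF M this polynomial_fun.const[of "1 / c"]] have "(\<lambda>x. f x ^ 0) \<in> M"
    using assms by simp
  then show False using avoids unfolding avoids_powers_def by blast
qed

text \<open>The complex numbers being algebraically closed, a nontrivial algebraic relation for a coordinate
  modulo a prime ideal fixes the value of this coordinate.\<close>

lemma maximal_avoiding_algebraic_coord:
  assumes "q \<noteq> 0" "(\<lambda>x. poly q (x $ i)) \<in> M"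
  shows "\<exists>b. (\<lambda>x. x $ i - b) \<in> M"
  using assms
proof (induction "degree q" arbitrary: q)
  case 0
  then obtain c where "q = [:c:]" "c \<noteq> 0" by (metis degree_eq_zeroE pCons_0_0)
  then show ?case using 0 maximal_avoiding_not_const[of c] by simp
next
  case (Suc n)
  then have "\<not> constant (poly q)" by (simp add: constant_degree)
  then obtain b where "poly q b = 0" using fundamental_theorem_of_algebra by blast
  then obtain r where r: "q = [:- b, 1:] * r" by (metis dvdE poly_eq_0_iff_dvd)
  have "r \<noteq> 0" using r Suc.prems(1) by auto
  have "degree q = degree r + 1" unfolding r by (subst degree_mult_eq) (use \<open>r \<noteq> 0\<close> in auto)
  then have "n = degree r" using Suc.hyps(2) by simp
  have poly_r: "polynomial_fun (\<lambda>x. poly r (x $ i))"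
    unfolding poly_altdef by (intro polynomial_fun_intros)
  have "(\<lambda>x. (x $ i - b) * poly r (x $ i)) \<in> M"
    using Suc.prems(2) by (simp add: r algebra_simps)
  then have "(\<lambda>x. x $ i - b) \<in> M \<or> (\<lambda>x. poly r (x $ i)) \<in> M"
    using maximal_avoiding_prime[of "\<lambda>x. x $ i - b" "\<lambda>x. poly r (x $ i)"] poly_r
      polynomial_fun_diff[OF polynomial_fun.coord polynomial_fun.const] by blast
  then show ?case using Suc.hyps(1)[OF \<open>n = degree r\<close> \<open>r \<noteq> 0\<close>] by blast
qed

text \<open>If no \<open>x\<^sub>i - a\<close> lies in \<open>M\<close>, then each of these uncountably many functions is invertible up to
  a power of \<open>f\<close>.  Infinitely many of the inverses \<open>g\<^sub>a\<close> share the power of \<open>f\<close> and a degree bound,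
  hence finitely many of them are linearly dependent.  Multiplying the dependence with the product
  of all \<open>x\<^sub>i - a\<close> involved gives an algebraic relation for \<open>x\<^sub>i\<close>.\<close>

lemma maximal_avoiding_coord: "\<exists>b. (\<lambda>x. x $ i - b) \<in> M"
proof (rule ccontr)
  assume "\<nexists>b. (\<lambda>x. x $ i - b) \<in> M"
  then have notin: "\<And>a. (\<lambda>x. x $ i - a) \<notin> M" by blast
  define Q where "Q a k s g m \<longleftrightarrow> m \<in> M \<and> degree_le s g \<and> polynomial_fun g \<and>
      (\<lambda>x. f x ^ k) = (\<lambda>x. m x + g x * (x $ i - a))" for a and k s :: nat and g m
  have "\<exists>k s g m. Q a k s g m" for a
  proof -
    have "polynomial_fun (\<lambda>x. x $ i - a)" by (intro polynomial_fun_intros)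
    from maximal_avoiding_unit[OF this notin] obtain k m g where
      kmg: "m \<in> M" "polynomial_fun g" "(\<lambda>x. f x ^ k) = (\<lambda>x. m x + g x * (x $ i - a))" by blast
    moreover obtain s where "degree_le s g" using polynomial_fun_degree[OF kmg(2)] by blast
    ultimately have "Q a k s g m" by (simp add: Q_def)
    then show ?thesis by blast
  qed
  then obtain k s g m where Q: "\<And>a. Q a (k a) (s a) (g a) (m a)" by metis
  have kg: "m a \<in> M" "degree_le (s a) (g a)" "polynomial_fun (g a)"
      "(\<lambda>x. f x ^ k a) = (\<lambda>x. m a x + g a x * (x $ i - a))" for a
    using Q[of a] by (simp_all add: Q_def)
  have "\<exists>y\<in>range (\<lambda>a. (k a, s a)). infinite {a \<in> UNIV. (k a, s a) = y}"
  proof (rule ccontr)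
    assume "\<not> ?thesis"
    then have fin: "finite {a. (k a, s a) = y}" if "y \<in> range (\<lambda>a. (k a, s a))" for y
      using that by auto
    have "finite {a. (k a, s a) = y}" for y
    proof (cases "y \<in> range (\<lambda>a. (k a, s a))")
      case False
      then have "{a. (k a, s a) = y} = {}" by auto
      then show ?thesis by simp
    qed (rule fin)
    then have "countable {a. (k a, s a) = y}" for y by (rule countable_finite)
    then have "countable (\<Union>y. {a. (k a, s a) = y})" by (intro countable_UN) auto
    moreover have "(\<Union>y. {a. (k a, s a) = y}) = UNIV" by auto
    ultimately show False using uncountable_UNIV_complex by simp
  qed
  then obtain K S where inf: "infinite {a. k a = K \<and> s a = S}" by auto
  obtain A where A: "finite A" "A \<subseteq> {a. k a = K \<and> s a = S}" "card A = Suc (card (lists_upto S :: 'n list set))"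
    using infinite_arbitrarily_large[OF inf] by blast
  have "card (lists_upto S :: 'n list set) < card A" using A(3) by simp
  moreover have "span_on UNIV monom_fun (lists_upto S) (g a)" if "a \<in> A" for a
    using kg(2)[of a] that A(2) unfolding degree_le_def by auto
  ultimately have "\<exists>d. (\<exists>a\<in>A. d a \<noteq> 0) \<and> (\<forall>x\<in>UNIV. (\<Sum>a\<in>A. d a * g a x) = 0)"
    using A(1) by (intro span_on_dependent) auto
  then obtain d where d: "\<exists>a\<in>A. d a \<noteq> 0" "\<And>x. (\<Sum>a\<in>A. d a * g a x) = 0" by auto
  define q where "q = (\<Sum>a\<in>A. smult (d a) (\<Prod>b\<in>A - {a}. [:- b, 1:]))"
  have poly_q: "poly q z = (\<Sum>a\<in>A. d a * (\<Prod>b\<in>A - {a}. z - b))" for z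
    by (simp add: q_def poly_sum poly_prod)
  obtain a where a: "a \<in> A" "d a \<noteq> 0" using d(1) by blast
  have "poly q a = d a * (\<Prod>b\<in>A - {a}. a - b)"
  proof -
    have "(\<Prod>b\<in>A - {a'}. a - b) = 0" if "a' \<in> A - {a}" for a'
      using that a A(1) by (auto intro!: bexI[of _ a])
    then have "(\<Sum>a'\<in>A - {a}. d a' * (\<Prod>b\<in>A - {a'}. a - b)) = 0" by (intro sum.neutral) auto
    then show ?thesis unfolding poly_q using A(1) a(1) by (simp add: sum.remove[of A a])
  qed
  then have "poly q a \<noteq> 0" using a A(1) by auto
  then have "q \<noteq> 0" by auto
  have "(\<lambda>x. f x ^ K * poly q (x $ i)) \<in> M"
  proof -
    have fK: "f x ^ K = m a x + g a x * (x $ i - a)" if "a \<in> A" for a x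
      using fun_cong[OF kg(4)[of a], of x] that A(2) by auto
    have "f x ^ K * poly q (x $ i) = (\<Sum>a\<in>A. (d a * (\<Prod>b\<in>A - {a}. x $ i - b)) * m a x)" (is "_ = ?S") for x
    proof -
      have "f x ^ K * poly q (x $ i) = (\<Sum>a\<in>A. (d a * (\<Prod>b\<in>A - {a}. x $ i - b)) * f x ^ K)"
        unfolding poly_q by (simp add: sum_distrib_left mult_ac)
      also have "\<dots> = (\<Sum>a\<in>A. (d a * (\<Prod>b\<in>A - {a}. x $ i - b)) * m a x
          + (d a * g a x) * ((x $ i - a) * (\<Prod>b\<in>A - {a}. x $ i - b)))"
        by (intro sum.cong refl) (simp add: fK algebra_simps)
      also have "\<dots> = ?S + (\<Sum>a\<in>A. (d a * g a x) * (\<Prod>b\<in>A. x $ i - b))"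
        using A(1) by (simp add: sum.distrib prod.remove[symmetric] cong: sum.cong)
      also have "\<dots> = ?S" using d(2)[of x] by (simp add: sum_distrib_right[symmetric])
      finally show ?thesis .
    qed
    then show ?thesis
      by (simp only:) (intro poly_ideal_sum[OF M] poly_ideal_mult[OF M] kg(1) polynomial_fun_intros)
  qed
  moreover have "polynomial_fun (\<lambda>x. f x ^ K)"
  proof -
    have "(\<lambda>x. f x ^ K) = (\<lambda>x. m a x + g a x * (x $ i - a))" using kg(4)[of a] a(1) A(2) by auto
    then show ?thesis using kg(1,3) poly_ideal_polynomial[OF M] by (auto intro!: polynomial_fun_intros)
  qed
  moreover have "polynomial_fun (\<lambda>x. poly q (x $ i))"
    unfolding poly_altdef by (intro polynomial_fun_intros)
  ultimately have "(\<lambda>x. poly q (x $ i)) \<in> M"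
    using maximal_avoiding_prime[of "\<lambda>x. f x ^ K" "\<lambda>x. poly q (x $ i)"] avoids
    unfolding avoids_powers_def by blast
  then show False using maximal_avoiding_algebraic_coord[OF \<open>q \<noteq> 0\<close>] notin by blast
qed

lemma maximal_avoiding_point:
  assumes b: "\<forall>i. (\<lambda>x. x $ i - b $ i) \<in> M" and g: "polynomial_fun g"
  shows "(\<lambda>x. g x - g b) \<in> M"
  using g
proof (induction rule: polynomial_fun.induct)
  case (const c)
  then show ?case using poly_ideal_zero[OF M] by simp
next
  case (coord i)
  then show ?case using b by blast
next
  case (add g h)
  have "(\<lambda>x. (g x - g b) + (h x - h b)) \<in> M" using add poly_ideal_add[OF M] by simp
  then show ?case by (simp add: algebra_simps)
next
  case (mult g h)
  have "(\<lambda>x. h x * (g x - g b) + g b * (h x - h b)) \<in> M"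
    using mult by (intro poly_ideal_add[OF M] poly_ideal_mult[OF M] polynomial_fun.const)
  then show ?case by (simp add: algebra_simps)
qed

end

text \<open>A maximal ideal among those that contain \<open>J\<close> and avoid the powers of \<open>f\<close> contains some
  \<open>x\<^sub>i - b\<^sub>i\<close> for every \<open>i\<close>.  It is therefore the ideal of the point \<open>b\<close>, and \<open>f\<close> does not belong
  to it.\<close>

theorem nullstellensatz:
  assumes J: "poly_ideal J" and f: "polynomial_fun f" and "\<And>k. (\<lambda>x. f x ^ k) \<notin> J"
  shows "\<exists>b. (\<forall>g\<in>J. g b = 0) \<and> f b \<noteq> 0"
proof -
  have "avoids_powers f J" using assms(3) by (simp add: avoids_powers_def)
  then obtain M where M: "poly_ideal M" "J \<subseteq> M" "avoids_powers f M"
      "\<forall>I. poly_ideal I \<longrightarrow> M \<subseteq> I \<longrightarrow> avoids_powers f I \<longrightarrow> I = M"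
    using exists_maximal_avoiding_ideal[OF J] by blast
  note max = M(1,3,4)
  have "\<forall>i. \<exists>b. (\<lambda>x. x $ i - b) \<in> M" using maximal_avoiding_coord[OF max] by blast
  then obtain b' where b': "\<And>i. (\<lambda>x. x $ i - b' i) \<in> M" by metis
  define b where "b = (\<chi> i. b' i)"
  have b: "\<forall>i. (\<lambda>x. x $ i - b $ i) \<in> M" using b' by (simp add: b_def)
  note at_point = maximal_avoiding_point[OF max b]
  have "g b = 0" if "g \<in> J" for g
  proof (rule ccontr)
    assume "g b \<noteq> 0"
    have "g \<in> M" "polynomial_fun g" using that M(2) poly_ideal_polynomial[OF J] by auto
    then have "(\<lambda>x. g x - (g x - g b)) \<in> M" using poly_ideal_diff[OF M(1)] at_point by blast
    then show False using maximal_avoiding_not_const[OF max \<open>g b \<noteq> 0\<close>] by simp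
  qed
  moreover have "f b \<noteq> 0"
  proof
    assume "f b = 0"
    then have "(\<lambda>x. f x ^ 1) \<in> M" using at_point[OF f] by simp
    then show False using M(3) unfolding avoids_powers_def by blast
  qed
  ultimately show ?thesis by blast
qed

section \<open>Linear forms bound the lengths of chains in a cone\<close>

text \<open>Invariance under all complex scalars, in contrast to the real cones of convex analysis; a nonempty
  cone in this sense contains the origin.\<close>

definition complex_cone :: "(complex ^ 'n) set \<Rightarrow> bool" where
  "complex_cone X \<longleftrightarrow> (\<forall>x\<in>X. \<forall>t. t *s x \<in> X)"

definition linear_form :: "(complex ^ 'n \<Rightarrow> complex) \<Rightarrow> bool" where
  "linear_form l \<longleftrightarrow> polynomial_fun l \<and> (\<forall>t x. l (t *s x) = t * l x)"

lemma zariski_closed_zeros: "polynomial_fun f \<Longrightarrow> zariski_closed {x. f x = 0}"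
  unfolding zariski_closed_def by (intro exI[of _ "{f}"]) auto

lemma zariski_irreducible_prime:
  assumes Z: "zariski_irreducible Z" and "polynomial_fun u" "polynomial_fun v"
    and "\<And>x. x \<in> Z \<Longrightarrow> u x * v x = 0"
  shows "(\<forall>x\<in>Z. u x = 0) \<or> (\<forall>x\<in>Z. v x = 0)"
proof -
  have "Z \<subseteq> {x. u x = 0} \<union> {x. v x = 0}" using assms(4) by auto
  then have "Z \<subseteq> {x. u x = 0} \<or> Z \<subseteq> {x. v x = 0}"
    using Z zariski_closed_zeros[OF assms(2)] zariski_closed_zeros[OF assms(3)]
    unfolding zariski_irreducible_def by blast
  then show ?thesis by blast
qed

text \<open>The Nullstellensatz for the ideal generated by the \<open>l\<^sub>k\<close> and the polynomials that vanish on \<open>X\<close>: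
  it has no zero other than the origin, where \<open>x\<^sub>i\<close> vanishes.\<close>

lemma coord_power_in_forms_ideal:
  fixes l :: "nat \<Rightarrow> complex ^ 'n \<Rightarrow> complex"
  assumes X: "zariski_closed X" and l: "\<forall>k<r. linear_form (l k)"
    and zero: "\<forall>x\<in>X. (\<forall>k<r. l k x = 0) \<longrightarrow> x = 0"
  shows "\<exists>N g. (\<forall>k<r. polynomial_fun (g k)) \<and> (\<forall>x\<in>X. (x $ i) ^ N = (\<Sum>k<r. l k x * g k x))"
proof -
  define J where "J = {f. polynomial_fun f \<and>
    (\<exists>g. (\<forall>k<r. polynomial_fun (g k)) \<and> (\<forall>x\<in>X. f x = (\<Sum>k<r. l k x * g k x)))}"
  have JI: "f \<in> J" if "polynomial_fun f" "\<And>k. k < r \<Longrightarrow> polynomial_fun (g k)"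
      "\<And>x. x \<in> X \<Longrightarrow> f x = (\<Sum>k<r. l k x * g k x)" for f g
    using that unfolding J_def by blast
  have J: "poly_ideal J"
    unfolding poly_ideal_def
  proof (intro conjI ballI allI impI)
    show "J \<subseteq> Collect polynomial_fun" by (auto simp: J_def)
    show "(\<lambda>x. 0) \<in> J" by (rule JI[of _ "\<lambda>k x. 0"]) (auto intro: polynomial_fun.const)
  next
    fix f f' assume "f \<in> J" "f' \<in> J"
    then obtain g g' where g: "polynomial_fun f" "polynomial_fun f'" "\<forall>k<r. polynomial_fun (g k)"
      "\<forall>k<r. polynomial_fun (g' k)" "\<forall>x\<in>X. f x = (\<Sum>k<r. l k x * g k x)"
      "\<forall>x\<in>X. f' x = (\<Sum>k<r. l k x * g' k x)" unfolding J_def by blast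
    show "(\<lambda>x. f x + f' x) \<in> J"
      by (rule JI[of _ "\<lambda>k x. g k x + g' k x"])
        (use g in \<open>auto intro: polynomial_fun.add simp: distrib_left sum.distrib\<close>)
  next
    fix f h :: "complex ^ 'n \<Rightarrow> complex" assume "f \<in> J" and h: "polynomial_fun h"
    then obtain g where g: "polynomial_fun f" "\<forall>k<r. polynomial_fun (g k)"
      "\<forall>x\<in>X. f x = (\<Sum>k<r. l k x * g k x)" unfolding J_def by blast
    show "(\<lambda>x. h x * f x) \<in> J"
      by (rule JI[of _ "\<lambda>k x. h x * g k x"])
        (use g h in \<open>auto intro: polynomial_fun.mult simp: sum_distrib_left mult_ac\<close>)
  qed
  have lJ: "l k \<in> J" if k: "k < r" for k
  proof (rule JI[of _ "\<lambda>k' x. if k' = k then 1 else 0"])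
    show "polynomial_fun (l k)" using l k by (simp add: linear_form_def)
    show "l k x = (\<Sum>k'<r. l k' x * (if k' = k then 1 else 0))" for x
      using k by (simp add: if_distrib[of "\<lambda>c. _ * c"] cong: if_cong)
  qed (auto intro: polynomial_fun.const)
  obtain P where P: "\<forall>p\<in>P. polynomial_fun p" "X = {x. \<forall>p\<in>P. p x = 0}"
    using X unfolding zariski_closed_def by blast
  have PJ: "p \<in> J" if "p \<in> P" for p
    by (rule JI[of _ "\<lambda>k x. 0"]) (use that P in \<open>auto intro: polynomial_fun.const\<close>)
  have "\<exists>N. (\<lambda>x. (x $ i) ^ N) \<in> J"
  proof (rule ccontr)
    assume "\<nexists>N. (\<lambda>x. (x $ i) ^ N) \<in> J"
    then obtain b where b: "\<forall>g\<in>J. g b = 0" "b $ i \<noteq> 0"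
      using nullstellensatz[OF J polynomial_fun.coord[of i]] by blast
    have "b \<in> X" using b(1) PJ P(2) by auto
    then have "b = 0" using zero b(1) lJ by blast
    then show False using b(2) by simp
  qed
  then show ?thesis unfolding J_def by auto
qed

lemma sum_lists_upto_by_length:
  "(\<Sum>ms\<in>lists_upto S. F ms) = (\<Sum>j\<le>S. \<Sum>ms | length ms = j. F ms)"
proof -
  have "(\<Sum>ms\<in>lists_upto S. F ms) = (\<Sum>j\<le>S. \<Sum>ms\<in>{ms \<in> lists_upto S. length ms = j}. F ms)"
    by (rule sum.group[OF finite_lists_upto, symmetric]) (auto simp: lists_upto_def)
  also have "\<dots> = (\<Sum>j\<le>S. \<Sum>ms | length ms = j. F ms)"
    by (intro sum.cong) (auto simp: lists_upto_def)
  finally show ?thesis .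
qed

text \<open>Comparing the coefficients of powers of \<open>t\<close> on the lines \<open>t x\<close>, which lie in the cone, allows
  one to replace each \<open>g\<^sub>k\<close> by its homogeneous part of degree \<open>N\<close>.\<close>

lemma coord_power_homogeneous:
  fixes l :: "nat \<Rightarrow> complex ^ 'n \<Rightarrow> complex"
  assumes X: "complex_cone X" and l: "\<forall>k<r. linear_form (l k)"
    and g: "\<And>k. k < r \<Longrightarrow> polynomial_fun (g k)"
    and eq: "\<And>x. x \<in> X \<Longrightarrow> (x $ i) ^ Suc N = (\<Sum>k<r. l k x * g k x)"
  shows "\<exists>h. (\<forall>k<r. span_on UNIV monom_fun {ms. length ms = N} (h k)) \<and>
    (\<forall>x\<in>X. (x $ i) ^ Suc N = (\<Sum>k<r. l k x * h k x))"
proof -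
  have "\<forall>k\<in>{..<r}. \<exists>s. degree_le s (g k)" using g polynomial_fun_degree by blast
  then obtain s where s: "\<And>k. k < r \<Longrightarrow> degree_le (s k) (g k)" by (metis lessThan_iff)
  define S where "S = N + (\<Sum>k<r. s k)"
  have "degree_le S (g k)" if "k < r" for k
    using s[OF that] by (rule degree_le_mono) (use that in \<open>auto simp: S_def intro!: trans_le_add2 member_le_sum\<close>)
  then have "\<forall>k\<in>{..<r}. \<exists>c. \<forall>x. g k x = (\<Sum>ms\<in>lists_upto S. c ms * monom_fun ms x)"
    unfolding degree_le_def span_on_def by auto
  then obtain c where c: "\<And>k x. k < r \<Longrightarrow> g k x = (\<Sum>ms\<in>lists_upto S. c k ms * monom_fun ms x)"
    by (metis lessThan_iff)
  define H where "H k j x = (\<Sum>ms | length ms = j. c k ms * monom_fun ms x)" for k j x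
  have scale: "g k (t *s x) = (\<Sum>j\<le>S. H k j x * t ^ j)" if "k < r" for k t x
    unfolding c[OF that] sum_lists_upto_by_length H_def sum_distrib_right
    by (intro sum.cong refl) (simp add: monom_fun_scale mult_ac)
  have "(x $ i) ^ Suc N = (\<Sum>k<r. l k x * H k N x)" if x: "x \<in> X" for x
  proof -
    define b where "b j = (\<Sum>k<r. l k x * H k j x) - (if j = N then (x $ i) ^ Suc N else 0)" for j
    define b' where "b' = case_nat 0 b"
    have "(\<Sum>j\<le>Suc S. b' j * t ^ j) = 0" for t
    proof -
      have "t *s x \<in> X" using x X by (simp add: complex_cone_def)
      from eq[OF this] have "t ^ Suc N * (x $ i) ^ Suc N = (\<Sum>k<r. (t * l k x) * (\<Sum>j\<le>S. H k j x * t ^ j))"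
        using l by (simp add: scale linear_form_def power_mult_distrib del: power_Suc)
      also have "\<dots> = (\<Sum>k<r. \<Sum>j\<le>S. l k x * H k j x * t ^ Suc j)"
        by (simp add: sum_distrib_left mult_ac)
      also have "\<dots> = (\<Sum>j\<le>S. (\<Sum>k<r. l k x * H k j x) * t ^ Suc j)"
        by (subst sum.swap) (simp add: sum_distrib_right)
      finally have "(\<Sum>j\<le>S. (\<Sum>k<r. l k x * H k j x) * t ^ Suc j) - t ^ Suc N * (x $ i) ^ Suc N = 0" by simp
      moreover have "(\<Sum>j\<le>S. (if j = N then (x $ i) ^ Suc N else 0) * t ^ Suc j) = t ^ Suc N * (x $ i) ^ Suc N"
        by (simp add: S_def if_distrib[of "\<lambda>c. c * _"] cong: if_cong)
      ultimately have "(\<Sum>j\<le>S. b j * t ^ Suc j) = 0"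
        unfolding b_def left_diff_distrib sum_subtractf by simp
      then show ?thesis by (simp add: sum.atMost_Suc_shift b'_def del: sum.atMost_Suc)
    qed
    then have "\<forall>j\<le>Suc S. b' j = 0" using polyfun_eq_0[of b' "Suc S"] by blast
    then have "b' (Suc N) = 0" by (simp add: S_def)
    then show ?thesis by (simp add: b_def b'_def)
  qed
  moreover have "span_on UNIV monom_fun {ms. length ms = N} (H k N)" for k
    unfolding span_on_def H_def by blast
  ultimately show ?thesis by (intro exI[of _ "\<lambda>k. H k N"]) auto
qed

lemma coord_powers_reduce:
  fixes l :: "nat \<Rightarrow> complex ^ 'n \<Rightarrow> complex"
  assumes X: "zariski_closed X" "complex_cone X" and l: "\<forall>k<r. linear_form (l k)"
    and zero: "\<forall>x\<in>X. (\<forall>k<r. l k x = 0) \<longrightarrow> x = 0"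
  shows "\<exists>N. \<forall>i. \<exists>h. (\<forall>k<r. span_on UNIV monom_fun {ms. length ms = N} (h k)) \<and>
    (\<forall>x\<in>X. (x $ i) ^ Suc N = (\<Sum>k<r. l k x * h k x))"
proof -
  have "\<forall>i. \<exists>N. \<exists>g. (\<forall>k<r. polynomial_fun (g k)) \<and> (\<forall>x\<in>X. (x $ i) ^ N = (\<Sum>k<r. l k x * g k x))"
    using coord_power_in_forms_ideal[OF X(1) l zero] by blast
  from choice[OF this] obtain N where
    N: "\<forall>i. \<exists>g. (\<forall>k<r. polynomial_fun (g k)) \<and> (\<forall>x\<in>X. (x $ i) ^ N i = (\<Sum>k<r. l k x * g k x))" ..
  define S where "S = (\<Sum>i\<in>UNIV. N i)"
  have "\<exists>h. (\<forall>k<r. span_on UNIV monom_fun {ms. length ms = S} (h k)) \<and>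
    (\<forall>x\<in>X. (x $ i) ^ Suc S = (\<Sum>k<r. l k x * h k x))" for i
  proof -
    obtain g where g: "\<forall>k<r. polynomial_fun (g k)"
      "\<forall>x\<in>X. (x $ i) ^ N i = (\<Sum>k<r. l k x * g k x)" using N by blast
    have "N i \<le> S" unfolding S_def by (rule member_le_sum) auto
    then have split: "(x $ i) ^ Suc S = (x $ i) ^ N i * (x $ i) ^ (Suc S - N i)" for x :: "complex ^ 'n"
      by (metis le_SucI power_add le_add_diff_inverse)
    show ?thesis
    proof (rule coord_power_homogeneous[OF X(2) l])
      show "polynomial_fun (\<lambda>x. g k x * (x $ i) ^ (Suc S - N i))" if "k < r" for k
        using g(1) that by (intro polynomial_fun_intros) auto
      show "(x $ i) ^ Suc S = (\<Sum>k<r. l k x * (g k x * (x $ i) ^ (Suc S - N i)))" if "x \<in> X" for x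
        unfolding split using g(2) that by (simp add: sum_distrib_right mult.assoc)
    qed
  qed
  then show ?thesis by blast
qed

definition power_product :: "(nat \<Rightarrow> 'x \<Rightarrow> complex) \<Rightarrow> nat list \<Rightarrow> 'x \<Rightarrow> complex" where
  "power_product f bs x = (\<Prod>i<length bs. f i x ^ (bs ! i))"

definition exponents :: "nat \<Rightarrow> nat \<Rightarrow> nat list set" where
  "exponents r s = {bs. set bs \<subseteq> {..s} \<and> length bs = r}"

lemma finite_exponents [simp]: "finite (exponents r s)"
  unfolding exponents_def by (rule finite_lists_length_eq) simp

lemma card_exponents: "card (exponents r s) = Suc s ^ r"
  unfolding exponents_def by (subst card_lists_length_eq) auto

lemma power_product_snoc:
  "power_product f (bs @ [m]) x = power_product f bs x * f (length bs) x ^ m"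
  by (simp add: power_product_def nth_append)

lemma power_product_increment:
  assumes "k < length bs"
  shows "power_product f (bs[k := Suc (bs ! k)]) x = f k x * power_product f bs x"
proof -
  have "(\<Prod>i\<in>{..<length bs} - {k}. f i x ^ (bs[k := Suc (bs ! k)] ! i)) = (\<Prod>i\<in>{..<length bs} - {k}. f i x ^ (bs ! i))"
    by (intro prod.cong) auto
  then show ?thesis
    using assms by (simp add: power_product_def prod.remove[of "{..<length bs}" k])
qed

lemma exponents_nth_le: "bs \<in> exponents r s \<Longrightarrow> k < r \<Longrightarrow> bs ! k \<le> s"
  unfolding exponents_def by (metis (mono_tags, lifting) atMost_iff mem_Collect_eq nth_mem subsetD)

lemma exponents_increment:
  assumes bs: "bs \<in> exponents r s" and k: "k < r"
  shows "bs[k := Suc (bs ! k)] \<in> exponents r (Suc s)"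
proof -
  have "set (bs[k := Suc (bs ! k)]) \<subseteq> insert (Suc (bs ! k)) (set bs)"
    by (rule set_update_subset_insert)
  also have "\<dots> \<subseteq> {..Suc s}" using bs exponents_nth_le[OF bs k] by (auto simp: exponents_def)
  finally show ?thesis using bs by (simp add: exponents_def)
qed

lemma exponents_Suc: "exponents (Suc r) s = (\<lambda>(m, bs). bs @ [m]) ` ({..s} \<times> exponents r s)"
proof -
  have "bs \<in> (\<lambda>(m, bs). bs @ [m]) ` ({..s} \<times> exponents r s)" if "bs \<in> exponents (Suc r) s" for bs
    using that by (cases bs rule: rev_cases) (auto simp: exponents_def)
  then show ?thesis by (auto simp: exponents_def)
qed

lemma sum_exponents_Suc:
  "(\<Sum>bs\<in>exponents (Suc r) s. F bs) = (\<Sum>m\<le>s. \<Sum>bs\<in>exponents r s. F (bs @ [m]))"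
  unfolding exponents_Suc
  by (subst sum.reindex) (auto simp: inj_on_def sum.cartesian_product split_def)

lemma long_list_repeats:
  fixes ms :: "'n::finite list"
  assumes "length ms > CARD('n) * N"
  shows "\<exists>i js. mset ms = mset (replicate (Suc N) i @ js)"
proof -
  have "\<exists>i. count_list ms i > N"
  proof (rule ccontr)
    assume "\<not> ?thesis"
    then have "(\<Sum>i\<in>UNIV. count_list ms i) \<le> (\<Sum>i\<in>(UNIV :: 'n set). N)"
      by (intro sum_mono) (simp add: not_less)
    then show False using assms sum_count_set[of ms UNIV] by simp
  qed
  then obtain i where "Suc N \<le> count (mset ms) i" by (auto simp: count_mset Suc_le_eq)
  then have "replicate_mset (Suc N) i \<subseteq># mset ms" by (simp add: count_le_replicate_mset_subset_eq)
  moreover obtain js where "mset js = mset ms - replicate_mset (Suc N) i" using ex_mset by blast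
  ultimately have "mset ms = mset (replicate (Suc N) i @ js)"
    by (metis mset_append mset_replicate subset_mset.add_diff_inverse)
  then show ?thesis by blast
qed

text \<open>The coordinate ring of \<open>X\<close> is a finite module over the subring generated by the forms \<open>l\<^sub>k\<close>,
  with control of the degrees: a monomial of large degree contains some \<open>x\<^sub>i\<close> to a high power, which
  can be traded for the factors \<open>l\<^sub>k\<close>, each exchange lowering the degree of the rest by one.\<close>

lemma cone_finite_over_forms:
  fixes l :: "nat \<Rightarrow> complex ^ 'n \<Rightarrow> complex"
  assumes X: "zariski_closed X" "complex_cone X" and l: "\<forall>k<r. linear_form (l k)"
    and zero: "\<forall>x\<in>X. (\<forall>k<r. l k x = 0) \<longrightarrow> x = 0"
  shows "\<exists>D. \<forall>s f. degree_le s f \<longrightarrow> span_on X (\<lambda>(bs, js) x. power_product l bs x * monom_fun js x)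
    (exponents r s \<times> lists_upto D) f"
proof -
  obtain N where "\<forall>i. \<exists>h. (\<forall>k<r. span_on UNIV monom_fun {ms. length ms = N} (h k)) \<and>
    (\<forall>x\<in>X. (x $ i) ^ Suc N = (\<Sum>k<r. l k x * h k x))"
    using coord_powers_reduce[OF X l zero] by blast
  from choice[OF this] obtain h where
    "\<forall>i. (\<forall>k<r. span_on UNIV monom_fun {ms. length ms = N} (h i k)) \<and>
      (\<forall>x\<in>X. (x $ i) ^ Suc N = (\<Sum>k<r. l k x * h i k x))" ..
  then have h: "\<And>i k. k < r \<Longrightarrow> span_on UNIV monom_fun {ms. length ms = N} (h i k)"
    "\<And>i x. x \<in> X \<Longrightarrow> (x $ i) ^ Suc N = (\<Sum>k<r. l k x * h i k x)" by auto
  define D where "D = CARD('n) * N"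
  define u where "u = (\<lambda>(bs, js) x. power_product l bs x * monom_fun js x)"
  let ?E = "\<lambda>s. exponents r s \<times> lists_upto D"
  have monom: "span_on X u (?E s) (monom_fun ms)" if "length ms \<le> s" for s ms
    using that
  proof (induction s arbitrary: ms)
    case 0
    have "(replicate r 0, ms) \<in> ?E 0" using 0 by (auto simp: exponents_def lists_upto_def)
    then have "span_on X u (?E 0) (u (replicate r 0, ms))" by (intro span_on_base) auto
    then show ?case by (rule span_on_cong) (simp add: u_def power_product_def)
  next
    case (Suc s)
    show ?case
    proof (cases "length ms \<le> D")
      case True
      then have "(replicate r 0, ms) \<in> ?E (Suc s)" by (auto simp: exponents_def lists_upto_def)
      then have "span_on X u (?E (Suc s)) (u (replicate r 0, ms))" by (intro span_on_base) auto
      then show ?thesis by (rule span_on_cong) (simp add: u_def power_product_def)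
    next
      case False
      then obtain i js where js: "mset ms = mset (replicate (Suc N) i @ js)"
        using long_list_repeats[of N ms] by (auto simp: D_def)
      have len: "length ms = Suc N + length js" using arg_cong[OF js, of size] by simp
      have step: "span_on X u (?E s) (\<lambda>x. h i k x * monom_fun js x)" if k: "k < r" for k
      proof (rule span_on_mult)
        show "span_on X monom_fun {ms. length ms = N} (h i k)"
          using h(1)[OF k] by (rule span_on_subset) simp
        show "span_on X monom_fun {js} (monom_fun js)" by (rule span_on_base) auto
        fix ns ks assume "ns \<in> {ms :: 'n list. length ms = N}" "ks \<in> {js}"
        then have "span_on X u (?E s) (monom_fun (ns @ ks))"
          using len Suc.prems by (intro Suc.IH) auto
        then show "span_on X u (?E s) (\<lambda>x. monom_fun ns x * monom_fun ks x)"
          by (simp add: monom_fun_append[abs_def])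
      qed
      have "span_on X u (?E (Suc s)) (\<lambda>x. l k x * (h i k x * monom_fun js x))" if k: "k < r" for k
      proof (rule span_on_mult[OF _ step[OF k]])
        show "span_on X (\<lambda>_. l k) {()} (l k)" by (rule span_on_base) auto
        fix b :: unit and c :: "nat list \<times> 'n list" assume "c \<in> ?E s"
        then obtain bs ks where c: "c = (bs, ks)" "bs \<in> exponents r s" "ks \<in> lists_upto D" by blast
        have "(bs[k := Suc (bs ! k)], ks) \<in> ?E (Suc s)" using c k exponents_increment by auto
        then have "span_on X u (?E (Suc s)) (u (bs[k := Suc (bs ! k)], ks))" by (intro span_on_base) auto
        moreover have "k < length bs" using c(2) k by (simp add: exponents_def)
        ultimately show "span_on X u (?E (Suc s)) (\<lambda>x. l k x * u c x)"
          by (simp add: u_def c(1) power_product_increment mult.assoc)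
      qed
      then have "span_on X u (?E (Suc s)) (\<lambda>x. \<Sum>k<r. l k x * (h i k x * monom_fun js x))"
        by (intro span_on_sum) auto
      then show ?thesis
      proof (rule span_on_cong)
        fix x assume x: "x \<in> X"
        have "monom_fun ms x = (x $ i) ^ Suc N * monom_fun js x"
          unfolding monom_fun_mset[OF js] monom_fun_append monom_fun_replicate ..
        then show "monom_fun ms x = (\<Sum>k<r. l k x * (h i k x * monom_fun js x))"
          unfolding h(2)[OF x] by (simp add: sum_distrib_right mult.assoc)
      qed
    qed
  qed
  have "span_on X u (?E s) f" if "degree_le s f" for s f
  proof (rule span_on_trans)
    show "span_on X monom_fun (lists_upto s) f"
      using that unfolding degree_le_def by (rule span_on_subset) simp
  qed (rule monom, simp add: lists_upto_def)
  then show ?thesis unfolding u_def by blast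
qed

definition irreducible_chain :: "nat \<Rightarrow> (nat \<Rightarrow> (complex ^ 'n) set) \<Rightarrow> (complex ^ 'n) set \<Rightarrow> bool" where
  "irreducible_chain k Z X \<longleftrightarrow>
     (\<forall>i\<le>k. zariski_closed (Z i) \<and> zariski_irreducible (Z i) \<and> Z i \<subseteq> X) \<and> (\<forall>i<k. Z i \<subset> Z (Suc i))"

text \<open>Functions \<open>f\<^sub>j\<close> that separate the consecutive members of a chain are algebraically independent
  on its largest member.  In a relation, one divides by the highest possible power of the last
  function, which is no zero divisor there, and restricts the rest to the previous member, where the
  last function vanishes.\<close>

lemma chain_power_products_independent:
  assumes irr: "\<And>i. i \<le> k \<Longrightarrow> zariski_irreducible (Z i)"
    and mono: "\<And>i. i < k \<Longrightarrow> Z i \<subseteq> Z (Suc i)"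
    and f: "\<And>i. i < k \<Longrightarrow> polynomial_fun (f i)"
    and f0: "\<And>i x. i < k \<Longrightarrow> x \<in> Z i \<Longrightarrow> f i x = 0"
    and f1: "\<And>i. i < k \<Longrightarrow> \<exists>x\<in>Z (Suc i). f i x \<noteq> 0"
    and "j \<le> k" "\<And>x. x \<in> Z j \<Longrightarrow> (\<Sum>bs\<in>exponents j M. d bs * power_product f bs x) = 0"
  shows "\<forall>bs\<in>exponents j M. d bs = 0"
  using assms(6,7)
proof (induction j arbitrary: d)
  case 0
  then obtain x where "x \<in> Z 0" using irr[of 0] by (auto simp: zariski_irreducible_def)
  moreover have "exponents 0 M = {[]}" by (auto simp: exponents_def)
  ultimately show ?case using 0(2) by (simp add: power_product_def)
next
  case (Suc j)
  define G where "G m x = (\<Sum>bs\<in>exponents j M. d (bs @ [m]) * power_product f bs x)" for m x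
  have jk: "j < k" using Suc.prems by simp
  have poly_G: "polynomial_fun (G m)" for m
    unfolding G_def power_product_def using f jk
    by (intro polynomial_fun_intros) (auto simp: exponents_def)
  have eq: "(\<Sum>m\<le>M. G m x * f j x ^ m) = 0" if "x \<in> Z (Suc j)" for x
  proof -
    have "(\<Sum>bs\<in>exponents (Suc j) M. d bs * power_product f bs x) = (\<Sum>m\<le>M. G m x * f j x ^ m)"
      unfolding sum_exponents_Suc G_def sum_distrib_right
      by (intro sum.cong refl) (auto simp: power_product_snoc exponents_def)
    then show ?thesis using Suc.prems(2)[OF that] by simp
  qed
  have "\<forall>bs\<in>exponents j M. d (bs @ [m]) = 0" if "m \<le> M" for m
    using that
  proof (induction m rule: less_induct)
    case (less m)
    have low: "G m' x = 0" if "m' < m" for m' x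
      unfolding G_def using less that by (intro sum.neutral) auto
    define R where "R x = (\<Sum>m'\<in>{m<..M}. G m' x * f j x ^ (m' - Suc m))" for x
    have poly_R: "polynomial_fun R"
      unfolding R_def using poly_G f[OF jk] by (intro polynomial_fun_intros) auto
    have fR: "f j x ^ m * (G m x + f j x * R x) = 0" if x: "x \<in> Z (Suc j)" for x
    proof -
      have "{..M} = {..<m} \<union> insert m {m<..M}" using less.prems by auto
      then have "(\<Sum>m'\<le>M. G m' x * f j x ^ m') = (\<Sum>m'\<in>insert m {m<..M}. G m' x * f j x ^ m')"
        by (intro sum.mono_neutral_right) (auto simp: low)
      also have "\<dots> = G m x * f j x ^ m + (\<Sum>m'\<in>{m<..M}. f j x ^ m * f j x * (G m' x * f j x ^ (m' - Suc m)))"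
      proof -
        have "f j x ^ m' = f j x ^ m * f j x * f j x ^ (m' - Suc m)" if "m' \<in> {m<..M}" for m'
        proof -
          have "m' = Suc m + (m' - Suc m)" using that by auto
          then have "f j x ^ m' = f j x ^ (Suc m + (m' - Suc m))" by simp
          then show ?thesis by (simp add: power_add mult_ac)
        qed
        then have "(\<Sum>m'\<in>{m<..M}. G m' x * f j x ^ m') =
          (\<Sum>m'\<in>{m<..M}. f j x ^ m * f j x * (G m' x * f j x ^ (m' - Suc m)))"
          by (intro sum.cong refl) (simp add: mult_ac)
        then show ?thesis by simp
      qed
      also have "\<dots> = f j x ^ m * (G m x + f j x * R x)"
        unfolding R_def sum_distrib_left[symmetric] by (simp add: algebra_simps)
      finally show ?thesis using eq[OF x] by simp
    qed
    have "(\<forall>x\<in>Z (Suc j). f j x ^ m = 0) \<or> (\<forall>x\<in>Z (Suc j). G m x + f j x * R x = 0)"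
      by (rule zariski_irreducible_prime)
        (use irr[of "Suc j"] jk f[OF jk] poly_G poly_R fR in \<open>auto intro!: polynomial_fun_intros\<close>)
    moreover have "\<not> (\<forall>x\<in>Z (Suc j). f j x ^ m = 0)" using f1[OF jk] by auto
    ultimately have "\<forall>x\<in>Z (Suc j). G m x + f j x * R x = 0" by blast
    then have "\<forall>x\<in>Z j. G m x = 0" using mono[OF jk] f0[OF jk] by force
    then show ?case using Suc.IH[of "\<lambda>bs. d (bs @ [m])"] jk by (auto simp: G_def)
  qed
  then show ?case by (auto simp: exponents_Suc)
qed

lemma irreducible_chain_separating:
  assumes "irreducible_chain k Z X"
  shows "\<exists>f. \<forall>i<k. polynomial_fun (f i) \<and> (\<forall>x\<in>Z i. f i x = 0) \<and> (\<exists>x\<in>Z (Suc i). f i x \<noteq> 0)"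
proof -
  have "\<exists>f. polynomial_fun f \<and> (\<forall>x\<in>Z i. f x = 0) \<and> (\<exists>x\<in>Z (Suc i). f x \<noteq> 0)" if "i < k" for i
  proof -
    have "zariski_closed (Z i)" "Z i \<subset> Z (Suc i)" using assms that by (auto simp: irreducible_chain_def)
    then obtain P x where "\<forall>p\<in>P. polynomial_fun p" "Z i = {x. \<forall>p\<in>P. p x = 0}" "x \<in> Z (Suc i)" "x \<notin> Z i"
      unfolding zariski_closed_def by blast
    then show ?thesis by blast
  qed
  then show ?thesis by metis
qed

text \<open>Growth comparison: a chain of length \<open>k\<close> produces \<open>(M + 1)\<^sup>k\<close> independent functions on \<open>X\<close>,
  of degrees bounded by a multiple of \<open>M\<close>, while the functions of such degrees on \<open>X\<close> form a space of
  dimension at most a multiple of \<open>(M + 1)\<^sup>r\<close>.\<close>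

theorem irreducible_chain_le_forms:
  fixes l :: "nat \<Rightarrow> complex ^ 'n \<Rightarrow> complex"
  assumes X: "zariski_closed X" "complex_cone X" and l: "\<forall>k<r. linear_form (l k)"
    and zero: "\<forall>x\<in>X. (\<forall>k<r. l k x = 0) \<longrightarrow> x = 0"
    and chain: "irreducible_chain k Z X"
  shows "k \<le> r"
proof (rule ccontr)
  assume "\<not> k \<le> r"
  then have rk: "Suc r \<le> k" by simp
  obtain D where D: "\<And>s f. degree_le s f \<Longrightarrow> span_on X
      (\<lambda>(bs, js) x. power_product l bs x * monom_fun js x) (exponents r s \<times> lists_upto D) f"
    using cone_finite_over_forms[OF X l zero] by blast
  obtain f where f: "\<And>i. i < k \<Longrightarrow> polynomial_fun (f i)" "\<And>i x. i < k \<Longrightarrow> x \<in> Z i \<Longrightarrow> f i x = 0"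
    "\<And>i. i < k \<Longrightarrow> \<exists>x\<in>Z (Suc i). f i x \<noteq> 0"
    using irreducible_chain_separating[OF chain] by blast
  have "\<forall>i\<in>{..<k}. \<exists>e. degree_le e (f i)" using f(1) polynomial_fun_degree by blast
  then obtain e' where e': "\<And>i. i < k \<Longrightarrow> degree_le (e' i) (f i)" by (metis lessThan_iff)
  define e where "e = (\<Sum>i<k. e' i)"
  have e: "degree_le e (f i)" if "i < k" for i
    using e'[OF that] by (rule degree_le_mono) (use that in \<open>auto simp: e_def intro!: member_le_sum\<close>)
  define C where "C = card (lists_upto D :: 'n list set)"
  \<comment> \<open>With this \<open>M\<close>, the dimension bound \<open>(k e M + 1)\<^sup>r C\<close> is at most \<open>M (M + 1)\<^sup>r\<close>.\<close>
  define M where "M = Suc (k * e) ^ r * C"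
  define s where "s = k * (e * M)"
  have deg: "degree_le s (power_product f bs)" if "bs \<in> exponents k M" for bs
  proof -
    have bs: "length bs = k" "\<And>i. i < k \<Longrightarrow> bs ! i \<le> M"
      using that exponents_nth_le[OF that] by (auto simp: exponents_def)
    have "degree_le (card {..<k} * (e * M)) (\<lambda>x. \<Prod>i<k. f i x ^ (bs ! i))"
    proof (rule degree_le_prod)
      fix i assume "i \<in> {..<k}"
      then show "degree_le (e * M) (\<lambda>x. f i x ^ (bs ! i))"
        using degree_le_power[OF e[of i], of "bs ! i"] bs(2)[of i] by (auto elim: degree_le_mono)
    qed simp
    then show ?thesis by (simp add: s_def power_product_def[abs_def] bs(1))
  qed
  have "card (exponents r s \<times> (lists_upto D :: 'n list set)) = Suc (k * e * M) ^ r * C"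
    by (simp add: card_cartesian_product card_exponents C_def s_def mult.assoc)
  also have "\<dots> \<le> (Suc (k * e) * Suc M) ^ r * C"
    by (intro mult_right_mono power_mono) auto
  also have "\<dots> = M * Suc M ^ r" unfolding power_mult_distrib by (simp add: M_def mult_ac)
  also have "\<dots> < Suc M ^ Suc r" by simp
  also have "\<dots> \<le> Suc M ^ k" using rk by (intro power_increasing) auto
  also have "\<dots> = card (exponents k M)" by (simp add: card_exponents)
  finally have less: "card (exponents r s \<times> (lists_upto D :: 'n list set)) < card (exponents k M)" .
  have "\<exists>d. (\<exists>bs\<in>exponents k M. d bs \<noteq> 0) \<and>
    (\<forall>x\<in>X. (\<Sum>bs\<in>exponents k M. d bs * power_product f bs x) = 0)"
    by (rule span_on_dependent[OF _ finite_exponents less]) (auto intro: D deg)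
  then obtain d where d: "\<exists>bs\<in>exponents k M. d bs \<noteq> 0"
    "\<forall>x\<in>X. (\<Sum>bs\<in>exponents k M. d bs * power_product f bs x) = 0" by blast
  have "Z k \<subseteq> X" using chain by (auto simp: irreducible_chain_def)
  then have zeroZ: "(\<Sum>bs\<in>exponents k M. d bs * power_product f bs x) = 0" if "x \<in> Z k" for x
    using d(2) that by blast
  have "\<forall>bs\<in>exponents k M. d bs = 0"
    by (rule chain_power_products_independent[of k Z f k, OF _ _ _ _ _ _ zeroZ])
      (use chain f in \<open>auto simp: irreducible_chain_def\<close>)
  then show False using d(1) by blast
qed

section \<open>Hilbert's basis theorem and irreducible components\<close>

definition subring :: "'r::comm_ring_1 set \<Rightarrow> bool" where
  "subring A \<longleftrightarrow> 0 \<in> A \<and> 1 \<in> A \<and> (\<forall>a\<in>A. \<forall>b\<in>A. a - b \<in> A \<and> a * b \<in> A)"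

lemma subring_add: "subring A \<Longrightarrow> a \<in> A \<Longrightarrow> b \<in> A \<Longrightarrow> a + b \<in> A"
  unfolding subring_def by (metis diff_0 diff_minus_eq_add)

lemma subring_sum: "subring A \<Longrightarrow> (\<And>i. i \<in> I \<Longrightarrow> f i \<in> A) \<Longrightarrow> sum f I \<in> A"
  by (induction I rule: infinite_finite_induct) (auto intro: subring_add simp: subring_def)

lemma subring_uminus_one: "subring A \<Longrightarrow> - 1 \<in> A"
  unfolding subring_def by (metis diff_0)

definition ideal_gen :: "'r::comm_ring_1 set \<Rightarrow> (nat \<Rightarrow> 'r) \<Rightarrow> nat \<Rightarrow> 'r set" where
  "ideal_gen B h n = {\<Sum>j<n. g j * h j | g. \<forall>j. g j \<in> B}"

context
  fixes B :: "'r::comm_ring_1 set"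
  assumes B: "subring B"
begin

lemma ideal_genI:
  assumes "\<And>j. j < n \<Longrightarrow> g j \<in> B"
  shows "(\<Sum>j<n. g j * h j) \<in> ideal_gen B h n"
  unfolding ideal_gen_def
  by (intro CollectI exI[of _ "\<lambda>j. if j < n then g j else 0"]) (use assms B in \<open>auto simp: subring_def\<close>)

lemma ideal_genE:
  assumes "p \<in> ideal_gen B h n"
  obtains g where "\<And>j. g j \<in> B" "p = (\<Sum>j<n. g j * h j)"
  using assms unfolding ideal_gen_def by blast

lemma ideal_gen_zero: "0 \<in> ideal_gen B h n"
  using ideal_genI[of n "\<lambda>_. 0" h] B by (simp add: subring_def)

lemma ideal_gen_add:
  assumes "p \<in> ideal_gen B h n" "q \<in> ideal_gen B h n"
  shows "p + q \<in> ideal_gen B h n"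
proof -
  obtain g g' where "\<And>j. g j \<in> B" "\<And>j. g' j \<in> B" "p = (\<Sum>j<n. g j * h j)" "q = (\<Sum>j<n. g' j * h j)"
    using assms ideal_genE by metis
  then show ?thesis
    using ideal_genI[of n "\<lambda>j. g j + g' j" h] subring_add[OF B] by (simp add: distrib_right sum.distrib)
qed

lemma ideal_gen_mult:
  assumes "p \<in> ideal_gen B h n" "b \<in> B"
  shows "b * p \<in> ideal_gen B h n"
proof -
  obtain g where "\<And>j. g j \<in> B" "p = (\<Sum>j<n. g j * h j)" using assms(1) ideal_genE by metis
  then show ?thesis
    using ideal_genI[of n "\<lambda>j. b * g j" h] B assms(2) by (simp add: sum_distrib_left subring_def mult.assoc)
qed

lemma ideal_gen_sum:
  "(\<And>i. i \<in> I \<Longrightarrow> p i \<in> ideal_gen B h n) \<Longrightarrow> (\<Sum>i\<in>I. p i) \<in> ideal_gen B h n"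
  by (induction I rule: infinite_finite_induct) (auto intro: ideal_gen_zero ideal_gen_add)

lemma ideal_gen_member:
  assumes "j < n"
  shows "h j \<in> ideal_gen B h n"
  using ideal_genI[of n "\<lambda>i. if i = j then 1 else 0" h] assms B
  by (simp add: subring_def if_distrib[of "\<lambda>c. c * _"] cong: if_cong)

lemma ideal_gen_subset:
  assumes "\<And>j. j < m \<Longrightarrow> h j \<in> ideal_gen B h' n"
  shows "ideal_gen B h m \<subseteq> ideal_gen B h' n"
proof
  fix p assume "p \<in> ideal_gen B h m"
  then obtain g where g: "\<And>j. g j \<in> B" "p = (\<Sum>j<m. g j * h j)" using ideal_genE by metis
  show "p \<in> ideal_gen B h' n" unfolding g(2) using assms g(1) by (intro ideal_gen_sum ideal_gen_mult) auto
qed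

lemma ideal_gen_mono: "m \<le> n \<Longrightarrow> ideal_gen B h m \<subseteq> ideal_gen B h n"
  by (intro ideal_gen_subset ideal_gen_member) auto

lemma ideal_gen_in_subring: "(\<And>j. h j \<in> B) \<Longrightarrow> ideal_gen B h n \<subseteq> B"
  unfolding ideal_gen_def using B by (auto intro!: subring_sum simp: subring_def)

lemma ideal_gen_cong: "(\<And>j. j < n \<Longrightarrow> h j = h' j) \<Longrightarrow> ideal_gen B h n = ideal_gen B h' n"
  unfolding ideal_gen_def by (intro Collect_cong ex_cong1) auto

end

text \<open>The ascending chain condition, for the ideals generated by the initial segments of a
  sequence.\<close>

definition noetherian :: "'r::comm_ring_1 set \<Rightarrow> bool" where
  "noetherian A \<longleftrightarrow> (\<forall>f. (\<forall>n. f n \<in> A) \<longrightarrow> (\<exists>N. f N \<in> ideal_gen A f N))"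

definition adjoin_upto :: "'r::comm_ring_1 set \<Rightarrow> 'r \<Rightarrow> nat \<Rightarrow> 'r set" where
  "adjoin_upto A x d = {\<Sum>k\<le>d. a k * x ^ k | a. \<forall>k. a k \<in> A}"

definition adjoin :: "'r::comm_ring_1 set \<Rightarrow> 'r \<Rightarrow> 'r set" where
  "adjoin A x = (\<Union>d. adjoin_upto A x d)"

context
  fixes A :: "'r::comm_ring_1 set" and x :: 'r
  assumes A: "subring A"
begin

lemma adjoin_uptoI: "(\<And>k. k \<le> d \<Longrightarrow> a k \<in> A) \<Longrightarrow> (\<Sum>k\<le>d. a k * x ^ k) \<in> adjoin_upto A x d"
  unfolding adjoin_upto_def
  by (intro CollectI exI[of _ "\<lambda>k. if k \<le> d then a k else 0"]) (use A in \<open>auto simp: subring_def\<close>)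

lemma adjoin_upto_mono:
  assumes "d \<le> e"
  shows "adjoin_upto A x d \<subseteq> adjoin_upto A x e"
proof
  fix f assume "f \<in> adjoin_upto A x d"
  then obtain a where a: "\<forall>k. a k \<in> A" "f = (\<Sum>k\<le>d. a k * x ^ k)" by (auto simp: adjoin_upto_def)
  have "f = (\<Sum>k\<le>e. (if k \<le> d then a k else 0) * x ^ k)"
    unfolding a(2) using assms by (intro sum.mono_neutral_cong_left) auto
  also have "\<dots> \<in> adjoin_upto A x e" using a(1) A by (intro adjoin_uptoI) (auto simp: subring_def)
  finally show "f \<in> adjoin_upto A x e" .
qed

lemma adjoin_upto_diff:
  assumes "f \<in> adjoin_upto A x d" "g \<in> adjoin_upto A x d"
  shows "f - g \<in> adjoin_upto A x d"
proof -
  obtain a b where ab: "\<forall>k. a k \<in> A" "\<forall>k. b k \<in> A"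
    "f = (\<Sum>k\<le>d. a k * x ^ k)" "g = (\<Sum>k\<le>d. b k * x ^ k)"
    using assms by (auto simp: adjoin_upto_def)
  have "f - g = (\<Sum>k\<le>d. (a k - b k) * x ^ k)" by (simp add: ab left_diff_distrib sum_subtractf)
  then show ?thesis using ab(1,2) A adjoin_uptoI[of d "\<lambda>k. a k - b k"] by (simp add: subring_def)
qed

lemma adjoin_upto_mult:
  assumes "f \<in> adjoin_upto A x d" "g \<in> adjoin_upto A x e"
  shows "f * g \<in> adjoin_upto A x (d + e)"
proof -
  obtain a b where ab: "\<forall>k. a k \<in> A" "\<forall>k. b k \<in> A"
    "f = (\<Sum>k\<le>d. a k * x ^ k)" "g = (\<Sum>k\<le>e. b k * x ^ k)"
    using assms by (auto simp: adjoin_upto_def)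
  define c where "c s = (\<Sum>(j, k) | j \<le> d \<and> k \<le> e \<and> j + k = s. a j * b k)" for s
  have "f * g = (\<Sum>(j, k)\<in>{..d} \<times> {..e}. a j * b k * x ^ (j + k))"
    unfolding ab sum_product by (simp add: sum.cartesian_product power_add mult_ac)
  also have "\<dots> = (\<Sum>s\<le>d + e. \<Sum>p\<in>{p \<in> {..d} \<times> {..e}. fst p + snd p = s}. (\<lambda>(j, k). a j * b k * x ^ (j + k)) p)"
    by (rule sum.group[symmetric]) auto
  also have "\<dots> = (\<Sum>s\<le>d + e. c s * x ^ s)"
    unfolding c_def sum_distrib_right by (intro sum.cong) auto
  also have "\<dots> \<in> adjoin_upto A x (d + e)"
    by (rule adjoin_uptoI) (use ab A in \<open>auto simp: c_def subring_def intro!: subring_sum[OF A]\<close>)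
  finally show ?thesis .
qed

lemma adjoin_memI: "f \<in> adjoin_upto A x d \<Longrightarrow> f \<in> adjoin A x"
  by (auto simp: adjoin_def)

lemma subset_adjoin: "A \<subseteq> adjoin A x"
  using adjoin_uptoI[of 0 "\<lambda>_. _"] adjoin_memI by fastforce

lemma gen_in_adjoin: "x \<in> adjoin A x"
  using adjoin_uptoI[of 1 "\<lambda>k. if k = 1 then 1 else 0"] A adjoin_memI[of x 1] by (auto simp: subring_def)

lemma subring_adjoin: "subring (adjoin A x)"
  unfolding subring_def
proof (intro conjI ballI)
  show "0 \<in> adjoin A x" "1 \<in> adjoin A x" using subset_adjoin A by (auto simp: subring_def)
  fix f g assume "f \<in> adjoin A x" "g \<in> adjoin A x"
  then obtain d e where "f \<in> adjoin_upto A x d" "g \<in> adjoin_upto A x e" by (auto simp: adjoin_def)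
  then have "f \<in> adjoin_upto A x (max d e)" "g \<in> adjoin_upto A x (max d e)" "f * g \<in> adjoin_upto A x (d + e)"
    using adjoin_upto_mono[of d "max d e"] adjoin_upto_mono[of e "max d e"] adjoin_upto_mult by auto
  then show "f - g \<in> adjoin A x" "f * g \<in> adjoin A x"
    using adjoin_upto_diff adjoin_memI by blast+
qed

lemma adjoin_lead:
  assumes "f \<in> adjoin_upto A x d"
  shows "\<exists>c\<in>A. f - c * x ^ d \<in> (if d = 0 then {0} else adjoin_upto A x (d - 1))"
proof -
  obtain a where a: "\<forall>k. a k \<in> A" "f = (\<Sum>k\<le>d. a k * x ^ k)" using assms by (auto simp: adjoin_upto_def)
  have "f - a d * x ^ d \<in> (if d = 0 then {0} else adjoin_upto A x (d - 1))"
    using a adjoin_uptoI[of "d - 1" a] by (cases d) auto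
  then show ?thesis using a(1) by blast
qed

text \<open>If a sequence \<open>f\<close> violates the chain condition in \<open>A[x]\<close>, choose repeatedly an element \<open>h\<^sub>n\<close> of
  minimal degree in the ideal of \<open>f\<close> outside the ideal of the earlier choices.  As \<open>A\<close> is
  noetherian, some leading coefficient is a combination of the earlier ones, and subtracting the
  corresponding combination of the earlier \<open>h\<^sub>j\<close> lowers the degree.  The degree of an element is the
  least one among its representations as a polynomial in \<open>x\<close>; these need not be unique.\<close>

theorem hilbert_basis:
  assumes "noetherian A"
  shows "noetherian (adjoin A x)"
proof (rule ccontr)
  let ?B = "adjoin A x"
  note B = subring_adjoin
  assume "\<not> noetherian ?B"
  then obtain f where f: "\<And>n. f n \<in> ?B" "\<And>N. f N \<notin> ideal_gen ?B f N"
    unfolding noetherian_def by blast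
  let ?gen = "ideal_gen ?B"
  define I where "I = (\<Union>n. ?gen f n)"
  have I_B: "I \<subseteq> ?B"
    unfolding I_def using ideal_gen_in_subring[OF B, of f] f(1) by blast
  have I_add: "p + q \<in> I" if pq: "p \<in> I" "q \<in> I" for p q
  proof -
    obtain m n where "p \<in> ?gen f m" "q \<in> ?gen f n" using pq by (auto simp: I_def)
    then have "p \<in> ?gen f (max m n)" "q \<in> ?gen f (max m n)"
      using ideal_gen_mono[OF B, of m "max m n" f] ideal_gen_mono[OF B, of n "max m n" f] by auto
    then show ?thesis unfolding I_def using ideal_gen_add[OF B] by blast
  qed
  have I_mult: "b * p \<in> I" if p: "p \<in> I" and b: "b \<in> ?B" for b p
  proof -
    obtain n where "p \<in> ?gen f n" using p by (auto simp: I_def)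
    then have "b * p \<in> ?gen f n" using b ideal_gen_mult[OF B] by blast
    then show ?thesis by (auto simp: I_def)
  qed
  have I_diff: "p - q \<in> I" if "p \<in> I" "q \<in> I" for p q
    using I_add[OF that(1) I_mult[OF that(2) subring_uminus_one[OF B]]] by simp
  have I_zero: "0 \<in> I" unfolding I_def using ideal_gen_zero[OF B] by blast
  have I_sum: "(\<Sum>i\<in>K. p i) \<in> I" if "\<And>i. i \<in> K \<Longrightarrow> p i \<in> I" for p and K :: "nat set"
    using that by (induction K rule: infinite_finite_induct) (auto intro: I_add I_zero)
  have not_fg: "\<exists>p\<in>I. p \<notin> ?gen h n" if h: "\<And>j. j < n \<Longrightarrow> h j \<in> I" for h n
  proof (rule ccontr)
    assume "\<not> ?thesis"
    then have sub: "I \<subseteq> ?gen h n" by blast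
    have "\<forall>j\<in>{..<n}. \<exists>m. h j \<in> ?gen f m" using h by (auto simp: I_def)
    then obtain m where m: "\<And>j. j < n \<Longrightarrow> h j \<in> ?gen f (m j)" by (metis lessThan_iff)
    define m' where "m' = (\<Sum>j<n. m j)"
    have "h j \<in> ?gen f m'" if j: "j < n" for j
    proof -
      have "m j \<le> m'" unfolding m'_def using j by (intro member_le_sum) auto
      then show ?thesis using m[OF j] ideal_gen_mono[OF B] by blast
    qed
    then have "?gen h n \<subseteq> ?gen f m'" by (rule ideal_gen_subset[OF B])
    moreover have "f m' \<in> I" unfolding I_def using ideal_gen_member[OF B, of m' "Suc m'" f] by blast
    ultimately have "f m' \<in> ?gen f m'" using sub by blast
    then show False using f(2) by blast
  qed
  define good where "good h n p d \<longleftrightarrow> p \<in> I \<and> p \<notin> ?gen h n \<and> p \<in> adjoin_upto A x d \<and>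
    (\<forall>p' d'. p' \<in> I \<longrightarrow> p' \<notin> ?gen h n \<longrightarrow> p' \<in> adjoin_upto A x d' \<longrightarrow> d \<le> d')" for h n p d
  have good_ex: "\<exists>p d. good h n p d" if h: "\<And>j. j < n \<Longrightarrow> h j \<in> I" for h n
  proof -
    have "\<exists>d p. p \<in> I \<and> p \<notin> ?gen h n \<and> p \<in> adjoin_upto A x d"
      using not_fg[of n h, OF h] I_B by (fastforce simp: adjoin_def)
    from exists_least_iff[THEN iffD1, OF this] show ?thesis unfolding good_def by (meson not_less)
  qed
  have "\<exists>h. \<forall>n. \<exists>d. good h n (h n) d"
  proof -
    \<comment> \<open>Each choice depends on all earlier ones, so the recursion carries the list of these.\<close>
    define H where "H hs = (SOME p. \<exists>d. good (\<lambda>j. hs ! j) (length hs) p d)" for hs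
    define hs where "hs = rec_nat [] (\<lambda>_ hs. hs @ [H hs])"
    have hs: "hs 0 = []" "\<And>n. hs (Suc n) = hs n @ [H (hs n)]" by (simp_all add: hs_def)
    have len: "length (hs n) = n" for n by (induction n) (auto simp: hs)
    have nth: "hs n ! j = H (hs j)" if "j < n" for n j
      using that by (induction n) (auto simp: hs nth_append len less_Suc_eq)
    define h where "h n = H (hs n)" for n
    have gen_eq: "?gen (\<lambda>j. hs n ! j) n = ?gen h n" for n
      by (rule ideal_gen_cong[OF B]) (simp add: nth h_def)
    have "\<exists>d. good h n (h n) d" for n
    proof (induction n rule: less_induct)
      case (less n)
      have "hs n ! j \<in> I" if "j < n" for j
        using less[OF that] by (auto simp: good_def nth[OF that] h_def)
      then have "\<exists>p d. good (\<lambda>j. hs n ! j) n p d" by (rule good_ex)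
      then have "\<exists>d. good (\<lambda>j. hs n ! j) n (h n) d"
        unfolding h_def H_def len by (rule someI_ex)
      then show ?case unfolding good_def gen_eq .
    qed
    then show ?thesis by blast
  qed
  then obtain h d where good: "\<And>n. good h n (h n) (d n)" by metis
  have hI: "h n \<in> I" and hn: "h n \<notin> ?gen h n" and hd: "h n \<in> adjoin_upto A x (d n)" for n
    using good[of n] by (auto simp: good_def)
  have min: "d n \<le> d'" if "p \<in> I" "p \<notin> ?gen h n" "p \<in> adjoin_upto A x d'" for n p d'
    using good[of n] that by (auto simp: good_def)
  have d_mono: "d j \<le> d n" if "j \<le> n" for j n
    using min[OF hI _ hd, of n j] hn[of n] ideal_gen_mono[OF B that, of h] by blast
  define low where "low d = (if d = 0 then {0} else adjoin_upto A x (d - 1))" for d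
  have "\<forall>n. \<exists>c. c \<in> A \<and> h n - c * x ^ d n \<in> low (d n)"
    using adjoin_lead[OF hd] unfolding low_def by blast
  from choice[OF this] obtain c where c: "\<And>n. c n \<in> A" "\<And>n. h n - c n * x ^ d n \<in> low (d n)"
    by blast
  obtain N where "c N \<in> ideal_gen A c N" using assms c(1) unfolding noetherian_def by blast
  then obtain g where g: "\<And>j. g j \<in> A" "c N = (\<Sum>j<N. g j * c j)" using ideal_genE[OF A] by metis
  define p where "p = (\<Sum>j<N. (g j * x ^ (d N - d j)) * h j)"
  have xB: "x ^ k \<in> ?B" for k
    by (induction k) (use gen_in_adjoin B in \<open>auto simp: subring_def\<close>)
  have gB: "g j * x ^ k \<in> ?B" for j k
    using g(1)[of j] subset_adjoin xB[of k] B by (auto simp: subring_def)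
  have p_gen: "p \<in> ?gen h N" unfolding p_def using gB by (intro ideal_genI[OF B])
  have q_notin: "h N - p \<notin> ?gen h N"
  proof
    assume "h N - p \<in> ?gen h N"
    from ideal_gen_add[OF B this p_gen] show False using hn by simp
  qed
  have q_I: "h N - p \<in> I"
    using hI gB by (auto simp: p_def intro!: I_diff I_sum I_mult)
  \<comment> \<open>The terms of degree \<open>d N\<close> cancel by the choice of \<open>g\<close>.\<close>
  have q_eq: "h N - p = (h N - c N * x ^ d N) - (\<Sum>j<N. (g j * x ^ (d N - d j)) * (h j - c j * x ^ d j))"
  proof -
    have "(g j * x ^ (d N - d j)) * (c j * x ^ d j) = g j * c j * x ^ d N" if "j < N" for j
      using d_mono[of j N] that by (simp add: mult_ac flip: power_add)
    then have "(\<Sum>j<N. (g j * x ^ (d N - d j)) * (c j * x ^ d j)) = c N * x ^ d N"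
      unfolding g(2) sum_distrib_right by (intro sum.cong) auto
    then show ?thesis by (simp add: p_def right_diff_distrib sum_subtractf)
  qed
  have low_mult: "(g j * x ^ (d N - d j)) * (h j - c j * x ^ d j) \<in> low (d N)" if j: "j < N" for j
  proof (cases "d j = 0")
    case True
    then have "h j - c j * x ^ d j = 0" using c(2)[of j] by (simp add: low_def)
    then have "(g j * x ^ (d N - d j)) * (h j - c j * x ^ d j) = 0" by (simp only: mult_zero_right)
    moreover have "0 \<in> adjoin_upto A x (d N - 1)"
      using adjoin_uptoI[of "d N - 1" "\<lambda>_. 0"] A by (simp add: subring_def)
    ultimately show ?thesis by (simp add: low_def)
  next
    case False
    then have "h j - c j * x ^ d j \<in> adjoin_upto A x (d j - 1)" using c(2)[of j] by (simp add: low_def)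
    moreover have "g j * x ^ (d N - d j) \<in> adjoin_upto A x (d N - d j)"
      using adjoin_uptoI[of "d N - d j" "\<lambda>k. if k = d N - d j then g j else 0"] g(1) j A
      by (simp add: subring_def if_distrib[of "\<lambda>c. c * _"] cong: if_cong)
    ultimately have "(g j * x ^ (d N - d j)) * (h j - c j * x ^ d j) \<in> adjoin_upto A x ((d N - d j) + (d j - 1))"
      by (intro adjoin_upto_mult)
    then show ?thesis using False d_mono[of j N] j by (simp add: low_def)
  qed
  have low_zero: "0 \<in> low e" for e
    using adjoin_uptoI[of "e - 1" "\<lambda>_. 0"] A by (simp add: subring_def low_def)
  have low_diff: "u - v \<in> low e" if "u \<in> low e" "v \<in> low e" for u v e
    using that adjoin_upto_diff by (auto simp: low_def split: if_splits)
  have low_add: "u + v \<in> low e" if "u \<in> low e" "v \<in> low e" for u v e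
    using low_diff[OF that(1) low_diff[OF low_zero that(2)]] by simp
  have low_sum: "(\<Sum>j\<in>K. u j) \<in> low e" if "\<And>j. j \<in> K \<Longrightarrow> u j \<in> low e" for u e and K :: "nat set"
    using that by (induction K rule: infinite_finite_induct) (auto intro: low_zero low_add)
  have "h N - p \<in> low (d N)"
    unfolding q_eq by (intro low_diff c(2) low_sum low_mult) simp
  then show False
    using q_notin ideal_gen_zero[OF B] min[OF q_I q_notin, of "d N - 1"] by (auto simp: low_def split: if_splits)
qed

end

lemma subring_power: "subring A \<Longrightarrow> a \<in> A \<Longrightarrow> a ^ k \<in> A"
  by (induction k) (auto simp: subring_def)

lemma adjoin_subset:
  assumes "subring B" "A \<subseteq> B" "x \<in> B"
  shows "adjoin A x \<subseteq> B"
proof -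
  have "a k * x ^ k \<in> B" if "\<forall>k. a k \<in> A" for a k
    using that assms(2) subring_power[OF assms(1,3), of k] assms(1) by (auto simp: subring_def)
  then show ?thesis
    by (auto simp: adjoin_def adjoin_upto_def intro!: subring_sum[OF assms(1)])
qed

lemma subring_polynomial_fun: "subring (Collect polynomial_fun :: (complex ^ 'n \<Rightarrow> complex) set)"
  unfolding subring_def
  by (auto simp: zero_fun_def one_fun_def fun_diff_def times_fun_def intro!: polynomial_fun_intros)

lemma noetherian_constants: "noetherian (range (\<lambda>c (x :: complex ^ 'n). c :: complex))" (is "noetherian ?C")
  unfolding noetherian_def
proof (intro allI impI)
  fix f :: "nat \<Rightarrow> complex ^ 'n \<Rightarrow> complex" assume "\<forall>n. f n \<in> ?C"
  then have "\<forall>n. \<exists>c. f n = (\<lambda>x. c)" by blast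
  then obtain c where c: "\<And>n. f n = (\<lambda>x. c n)" by metis
  show "\<exists>N. f N \<in> ideal_gen ?C f N"
  proof (cases "c 0 = 0")
    case True
    then have "f 0 = 0" by (simp add: c zero_fun_def)
    then have "f 0 \<in> ideal_gen ?C f 0"
      unfolding ideal_gen_def by (intro CollectI exI[of _ "\<lambda>j x. 0"]) auto
    then show ?thesis ..
  next
    case False
    then have "f 1 = (\<Sum>j<1. (\<lambda>x. c 1 / c 0) * f j)" by (simp add: c times_fun_def)
    then have "f 1 \<in> ideal_gen ?C f 1"
      unfolding ideal_gen_def by (intro CollectI exI[of _ "\<lambda>j x. c 1 / c 0"]) auto
    then show ?thesis ..
  qed
qed

theorem noetherian_polynomial_fun: "noetherian (Collect polynomial_fun :: (complex ^ 'n \<Rightarrow> complex) set)"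
proof -
  let ?P = "Collect polynomial_fun :: (complex ^ 'n \<Rightarrow> complex) set"
  let ?C = "range (\<lambda>c (x :: complex ^ 'n). c :: complex)"
  have "\<exists>B. subring B \<and> noetherian B \<and> ?C \<subseteq> B \<and> (\<forall>i\<in>S. (\<lambda>x. x $ i) \<in> B) \<and> B \<subseteq> ?P"
    if "finite S" for S :: "'n set"
    using that
  proof (induction S rule: finite_induct)
    case empty
    have "subring ?C"
      by (auto simp: subring_def zero_fun_def one_fun_def fun_diff_def times_fun_def)
    then show ?case using noetherian_constants by (intro exI[of _ ?C]) (auto intro: polynomial_fun.const)
  next
    case (insert i S)
    then obtain B where B: "subring B" "noetherian B" "?C \<subseteq> B" "\<forall>i\<in>S. (\<lambda>x. x $ i) \<in> B" "B \<subseteq> ?P" by blast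
    have "adjoin B (\<lambda>x. x $ i) \<subseteq> ?P"
      using subring_polynomial_fun B(5) by (rule adjoin_subset) (auto intro: polynomial_fun.coord)
    then show ?case
      using B subset_adjoin[OF B(1), of "\<lambda>x. x $ i"] gen_in_adjoin[OF B(1), of "\<lambda>x. x $ i"]
        subring_adjoin[OF B(1)] hilbert_basis[OF B(1,2)]
      by (intro exI[of _ "adjoin B (\<lambda>x. x $ i)"]) blast
  qed
  from this[of UNIV] obtain B where
    B: "subring B" "noetherian B" "?C \<subseteq> B" "\<forall>i. (\<lambda>x. x $ i) \<in> B" "B \<subseteq> ?P" by auto
  have "p \<in> B" if "polynomial_fun p" for p
    using that
  proof (induction rule: polynomial_fun.induct)
    case (add f g)
    then show ?case using subring_add[OF B(1), of f g] by (simp add: plus_fun_def)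
  next
    case (mult f g)
    then have "f * g \<in> B" using B(1) by (simp add: subring_def)
    then show ?case by (simp add: times_fun_def)
  qed (use B in auto)
  then have "B = ?P" using B(5) by auto
  then show ?thesis using B(2) by simp
qed

lemma zariski_closedE:
  assumes "zariski_closed X" "y \<notin> X"
  obtains p where "polynomial_fun p" "\<And>x. x \<in> X \<Longrightarrow> p x = 0" "p y \<noteq> 0"
  using assms unfolding zariski_closed_def by blast

lemma zariski_closedI:
  assumes "\<And>y. y \<notin> X \<Longrightarrow> \<exists>p. polynomial_fun p \<and> (\<forall>x\<in>X. p x = 0) \<and> p y \<noteq> 0"
  shows "zariski_closed X"
  unfolding zariski_closed_def
  by (intro exI[of _ "{p. polynomial_fun p \<and> (\<forall>x\<in>X. p x = 0)}"]) (use assms in blast)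

lemma zariski_closed_Inter: "(\<And>X. X \<in> \<F> \<Longrightarrow> zariski_closed X) \<Longrightarrow> zariski_closed (\<Inter>\<F>)"
  by (rule zariski_closedI) (metis Inter_iff zariski_closedE)

lemma zariski_closed_Int: "zariski_closed X \<Longrightarrow> zariski_closed Y \<Longrightarrow> zariski_closed (X \<inter> Y)"
  using zariski_closed_Inter[of "{X, Y}"] by auto

lemma zariski_closed_Un:
  assumes "zariski_closed X" "zariski_closed Y"
  shows "zariski_closed (X \<union> Y)"
proof (rule zariski_closedI)
  fix y assume "y \<notin> X \<union> Y"
  then obtain p q where "polynomial_fun p" "\<And>x. x \<in> X \<Longrightarrow> p x = 0" "p y \<noteq> 0"
    "polynomial_fun q" "\<And>x. x \<in> Y \<Longrightarrow> q x = 0" "q y \<noteq> 0"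
    using assms zariski_closedE by (metis UnI1 UnI2)
  then show "\<exists>p. polynomial_fun p \<and> (\<forall>x\<in>X \<union> Y. p x = 0) \<and> p y \<noteq> 0"
    by (intro exI[of _ "\<lambda>x. p x * q x"]) (auto intro: polynomial_fun.mult)
qed

lemma zariski_closed_empty: "zariski_closed {}"
  by (rule zariski_closedI) (auto intro!: exI[of _ "\<lambda>x. 1"] polynomial_fun.const)

lemma zariski_closed_Union:
  "finite \<F> \<Longrightarrow> (\<And>X. X \<in> \<F> \<Longrightarrow> zariski_closed X) \<Longrightarrow> zariski_closed (\<Union>\<F>)"
  by (induction \<F> rule: finite_induct) (auto intro: zariski_closed_empty zariski_closed_Un)

lemma zariski_closed_singleton: "zariski_closed {a}"
proof (rule zariski_closedI)
  fix y assume "y \<notin> {a}"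
  then obtain i where "y $ i \<noteq> a $ i" by (auto simp: vec_eq_iff)
  then show "\<exists>p. polynomial_fun p \<and> (\<forall>x\<in>{a}. p x = 0) \<and> p y \<noteq> 0"
    by (intro exI[of _ "\<lambda>x. x $ i - a $ i"]) (auto intro!: polynomial_fun_intros)
qed

text \<open>Along a strictly descending sequence, choose \<open>p\<^sub>i\<close> that vanishes on the \<open>(i + 1)\<close>-st set but not
  on the \<open>i\<close>-th.  If \<open>p\<^sub>N\<close> is a combination of \<open>p\<^sub>0, \<dots>, p\<^sub>N\<^sub>-\<^sub>1\<close>, it vanishes on the \<open>N\<close>-th set,
  where all of these vanish.\<close>

lemma wf_zariski_closed: "wf {(X, Y). zariski_closed X \<and> zariski_closed Y \<and> X \<subset> (Y :: (complex ^ 'n) set)}"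
  unfolding wf_iff_no_infinite_down_chain
proof
  assume "\<exists>X. \<forall>i. (X (Suc i), X i) \<in> {(X, Y). zariski_closed X \<and> zariski_closed Y \<and> X \<subset> (Y :: (complex ^ 'n) set)}"
  then obtain X :: "nat \<Rightarrow> (complex ^ 'n) set" where
    X: "\<And>i. zariski_closed (X i)" "\<And>i. X (Suc i) \<subset> X i" by blast
  have "\<exists>p. polynomial_fun p \<and> (\<forall>x\<in>X (Suc i). p x = 0) \<and> (\<exists>x\<in>X i. p x \<noteq> 0)" for i
  proof -
    obtain y where "y \<in> X i" "y \<notin> X (Suc i)" using X(2) by blast
    then show ?thesis using zariski_closedE[OF X(1)] by metis
  qed
  then obtain p where p: "\<And>i. polynomial_fun (p i)" "\<And>i x. x \<in> X (Suc i) \<Longrightarrow> p i x = 0"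
    "\<And>i. \<exists>x\<in>X i. p i x \<noteq> 0" by metis
  obtain N where N: "p N \<in> ideal_gen (Collect polynomial_fun) p N"
    using noetherian_polynomial_fun p(1) unfolding noetherian_def by blast
  then obtain g where g: "p N = (\<Sum>j<N. g j * p j)" unfolding ideal_gen_def by blast
  have eval: "(\<Sum>j<m. g j * p j) x = (\<Sum>j<m. g j x * p j x)" for m x by (induction m) auto
  have anti: "X N \<subseteq> X (Suc j)" if "j < N" for j
    using lift_Suc_antimono_le[of X "Suc j" N] X(2) that by fastforce
  have "p N x = 0" if "x \<in> X N" for x
    unfolding g eval using anti p(2) that by (intro sum.neutral) auto
  then show False using p(3) by blast
qed

lemmas zariski_closed_induct = wf_induct_rule[OF wf_zariski_closed, case_names less]

lemma irreducible_decomposition: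
  assumes "zariski_closed X"
  shows "\<exists>\<F>. finite \<F> \<and> (\<forall>C\<in>\<F>. zariski_closed C \<and> zariski_irreducible C) \<and> X = \<Union>\<F>"
  using assms
proof (induction X rule: zariski_closed_induct)
  case (less X)
  consider "X = {}" | "zariski_irreducible X"
    | A B where "zariski_closed A" "zariski_closed B" "X \<subseteq> A \<union> B" "\<not> X \<subseteq> A" "\<not> X \<subseteq> B"
    unfolding zariski_irreducible_def by blast
  then show ?case
  proof cases
    case 1
    then show ?thesis by (intro exI[of _ "{}"]) auto
  next
    case 2
    then show ?thesis using less by (intro exI[of _ "{X}"]) auto
  next
    case (3 A B)
    have AB: "zariski_closed (X \<inter> A)" "zariski_closed (X \<inter> B)"
      using zariski_closed_Int less.prems 3 by auto
    obtain \<F> where F: "finite \<F>" "\<forall>C\<in>\<F>. zariski_closed C \<and> zariski_irreducible C" "X \<inter> A = \<Union>\<F>"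
      using less.IH[of "X \<inter> A"] AB less.prems 3 by auto
    obtain \<G> where G: "finite \<G>" "\<forall>C\<in>\<G>. zariski_closed C \<and> zariski_irreducible C" "X \<inter> B = \<Union>\<G>"
      using less.IH[of "X \<inter> B"] AB less.prems 3 by auto
    have "X = (X \<inter> A) \<union> (X \<inter> B)" using 3(3) by blast
    then have "X = \<Union>(\<F> \<union> \<G>)" unfolding F(3) G(3) by simp
    then show ?thesis using F G by (intro exI[of _ "\<F> \<union> \<G>"]) auto
  qed
qed

lemma irreducible_in_finite_Union:
  assumes "zariski_irreducible Z"
  shows "finite \<F> \<Longrightarrow> (\<And>C. C \<in> \<F> \<Longrightarrow> zariski_closed C) \<Longrightarrow> Z \<subseteq> \<Union>\<F> \<Longrightarrow> \<exists>C\<in>\<F>. Z \<subseteq> C"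
proof (induction \<F> rule: finite_induct)
  case empty
  then show ?case using assms by (auto simp: zariski_irreducible_def)
next
  case (insert C \<F>)
  have "zariski_closed C" "zariski_closed (\<Union>\<F>)" "Z \<subseteq> C \<union> \<Union>\<F>"
    using insert.prems insert.hyps(1) by (auto intro: zariski_closed_Union)
  then have "Z \<subseteq> C \<or> Z \<subseteq> \<Union>\<F>" using assms unfolding zariski_irreducible_def by blast
  then show ?case using insert by auto
qed


section \<open>Long chains in cones\<close>

lemma zariski_irreducible_singleton: "zariski_irreducible {a}"
  by (auto simp: zariski_irreducible_def)

lemma polynomial_fun_on_line:
  assumes "polynomial_fun p"
  shows "\<exists>q. \<forall>t. poly q t = p (t *s x)"
  using assms
proof (induction rule: polynomial_fun.induct)
  case (const c)
  show ?case by (intro exI[of _ "[:c:]"]) simp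
next
  case (coord i)
  show ?case by (intro exI[of _ "[:0, x $ i:]"]) simp
next
  case (add f g)
  then show ?case by (metis poly_add)
next
  case (mult f g)
  then show ?case by (metis poly_mult)
qed

text \<open>Restricted to the line, polynomial functions are polynomials in one variable, and these form an
  integral domain.\<close>

lemma zariski_irreducible_line: "zariski_irreducible (range (\<lambda>t. t *s (x :: complex ^ 'n)))"
  unfolding zariski_irreducible_def
proof (intro conjI allI impI)
  fix A B assume A: "zariski_closed A" and B: "zariski_closed B" and sub: "range (\<lambda>t. t *s x) \<subseteq> A \<union> B"
  show "range (\<lambda>t. t *s x) \<subseteq> A \<or> range (\<lambda>t. t *s x) \<subseteq> B"
  proof (rule ccontr)
    assume "\<not> ?thesis"
    then obtain s t where "s *s x \<notin> A" "t *s x \<notin> B" by auto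
    then obtain p q where p: "polynomial_fun p" "\<And>y. y \<in> A \<Longrightarrow> p y = 0" "p (s *s x) \<noteq> 0"
      and q: "polynomial_fun q" "\<And>y. y \<in> B \<Longrightarrow> q y = 0" "q (t *s x) \<noteq> 0"
      using A B zariski_closedE by metis
    obtain p' q' where pq': "\<And>t. poly p' t = p (t *s x)" "\<And>t. poly q' t = q (t *s x)"
      using polynomial_fun_on_line[OF p(1), of x] polynomial_fun_on_line[OF q(1), of x] by blast
    have "poly (p' * q') t = 0" for t
      using sub p(2) q(2) by (auto simp: pq')
    then have "p' = 0 \<or> q' = 0" by (metis mult_eq_0_iff poly_all_0_iff_0)
    then show False using p(3) q(3) pq' by (metis poly_0)
  qed
qed auto

lemma linear_form_dot: "linear_form (\<lambda>x. \<Sum>i\<in>UNIV. a $ i * x $ i)"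
  unfolding linear_form_def
  by (auto intro!: polynomial_fun_intros simp: sum_distrib_left mult_ac)

text \<open>Points are added one at a time: if the form \<open>a\<close> is nonzero on the earlier points and \<open>b\<close> is
  nonzero on the new one, then \<open>a + t b\<close> is nonzero on all of them except for finitely many \<open>t\<close>.\<close>

lemma exists_linear_form_nonzero_on:
  assumes "finite F" "0 \<notin> (F :: (complex ^ 'n) set)"
  shows "\<exists>l. linear_form l \<and> (\<forall>z\<in>F. l z \<noteq> 0)"
proof -
  define dot where "dot a x = (\<Sum>i\<in>UNIV. a $ i * x $ i)" for a x :: "complex ^ 'n"
  have dot_line: "dot (a + t *s b) x = dot a x + t * dot b x" for a b x t
    by (simp add: dot_def distrib_right sum.distrib sum_distrib_left mult.assoc)
  have "\<exists>a. \<forall>z\<in>F. dot a z \<noteq> 0"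
    using assms
  proof (induction F rule: finite_induct)
    case empty
    then show ?case by simp
  next
    case (insert z F)
    then obtain a where a: "\<forall>z\<in>F. dot a z \<noteq> 0" by auto
    obtain i where i: "z $ i \<noteq> 0" using insert.prems by (auto simp: vec_eq_iff)
    define b where "b = (axis i 1 :: complex ^ 'n)"
    have bz: "dot b z \<noteq> 0"
      using i by (simp add: dot_def b_def axis_def if_distrib[of "\<lambda>c. c * _"] cong: if_cong)
    let ?bad = "(\<lambda>y. - dot a y / dot b y) ` insert z F"
    obtain t where t: "t \<notin> ?bad"
      using ex_new_if_finite[OF infinite_UNIV_char_0, of ?bad] insert.hyps(1) by auto
    have "dot (a + t *s b) y \<noteq> 0" if y: "y \<in> insert z F" for y
    proof
      assume eq: "dot (a + t *s b) y = 0"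
      show False
      proof (cases "dot b y = 0")
        case True
        then show False using eq y a bz by (auto simp: dot_line)
      next
        case False
        then have "t = - dot a y / dot b y"
          using eq by (simp add: dot_line field_simps add_eq_0_iff)
        then show False using t y by blast
      qed
    qed
    then show ?case by blast
  qed
  then show ?thesis using linear_form_dot unfolding dot_def by blast
qed

text \<open>A linear form that vanishes identically on no irreducible component of \<open>X\<close> other than \<open>{0}\<close>
  cuts out a smaller cone.  The top member of a chain in the smaller cone lies in a component of
  \<open>X\<close>, and properly so, because the form vanishes on the former only: the chain can be prolonged.
  If the smaller cone is \<open>{0}\<close>, the new member has to be taken as a component of positive dimension,
  such as one containing a line.\<close>

theorem cone_forms_and_chain:
  fixes X :: "(complex ^ 'n) set"
  assumes "zariski_closed X" "complex_cone X" "0 \<in> X"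
  shows "\<exists>r l Z. (\<forall>k<r. linear_form (l k)) \<and> (\<forall>x\<in>X. (\<forall>k<r. l k x = 0) \<longrightarrow> x = 0) \<and>
    irreducible_chain r Z X"
  using assms
proof (induction X rule: zariski_closed_induct)
  case (less X)
  show ?case
  proof (cases "X = {0}")
    case True
    have "irreducible_chain 0 (\<lambda>_. {0}) X"
      using True by (auto simp: irreducible_chain_def zariski_closed_singleton zariski_irreducible_singleton)
    then show ?thesis using True by (intro exI[of _ 0]) auto
  next
    case False
    then obtain x where x: "x \<in> X" "x \<noteq> 0" using less.prems(3) by blast
    obtain \<F> where F: "finite \<F>" "\<And>C. C \<in> \<F> \<Longrightarrow> zariski_closed C"
      "\<And>C. C \<in> \<F> \<Longrightarrow> zariski_irreducible C" "X = \<Union>\<F>"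
      using irreducible_decomposition[OF less.prems(1)] by blast
    have "\<forall>C\<in>{C \<in> \<F>. \<not> C \<subseteq> {0}}. \<exists>z. z \<in> C \<and> z \<noteq> 0" by blast
    from bchoice[OF this] obtain z where z: "\<And>C. C \<in> \<F> \<Longrightarrow> \<not> C \<subseteq> {0} \<Longrightarrow> z C \<in> C \<and> z C \<noteq> 0" by blast
    have "0 \<notin> z ` {C \<in> \<F>. \<not> C \<subseteq> {0}}" using z by force
    then obtain m where m: "linear_form m" "\<And>C. C \<in> \<F> \<Longrightarrow> \<not> C \<subseteq> {0} \<Longrightarrow> m (z C) \<noteq> 0"
      using exists_linear_form_nonzero_on[of "z ` {C \<in> \<F>. \<not> C \<subseteq> {0}}"] F(1) by auto
    define Y where "Y = X \<inter> {x. m x = 0}"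
    have "zariski_closed Y"
      unfolding Y_def using less.prems(1) m(1)
      by (intro zariski_closed_Int zariski_closed_zeros) (auto simp: linear_form_def)
    moreover have "complex_cone Y"
      using less.prems(2) m(1) by (auto simp: complex_cone_def Y_def linear_form_def)
    moreover have "0 \<in> Y"
    proof -
      have "m (0 *s 0) = 0 * m 0" using m(1) unfolding linear_form_def by blast
      then show ?thesis using less.prems(3) by (simp add: Y_def)
    qed
    moreover have "Y \<subset> X"
    proof -
      obtain C where "C \<in> \<F>" "x \<in> C" using x F(4) by blast
      then have "z C \<in> X - Y" using z[of C] m(2)[of C] x(2) F(4) by (auto simp: Y_def)
      then show ?thesis by (auto simp: Y_def)
    qed
    ultimately obtain r l Z where r: "\<forall>k<r. linear_form (l k)"
      "\<forall>x\<in>Y. (\<forall>k<r. l k x = 0) \<longrightarrow> x = 0" "irreducible_chain r Z Y"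
      using less.IH[of Y] less.prems(1) by blast
    let ?l = "l(r := m)"
    have forms: "\<forall>k<Suc r. linear_form (?l k)" using r(1) m(1) by (auto simp: less_Suc_eq)
    have zero: "\<forall>x\<in>X. (\<forall>k<Suc r. ?l k x = 0) \<longrightarrow> x = 0"
      using r(2) by (auto simp: Y_def less_Suc_eq all_conj_distrib)
    have ZY: "\<And>i. i \<le> r \<Longrightarrow> Z i \<subseteq> Y" "zariski_irreducible (Z r)" using r(3) by (auto simp: irreducible_chain_def)
    have "\<exists>C\<in>\<F>. Z r \<subset> C"
    proof (cases r)
      case 0
      have "range (\<lambda>t. t *s x) \<subseteq> \<Union>\<F>" using less.prems(2) x(1) F(4) by (auto simp: complex_cone_def)
      then obtain C where C: "C \<in> \<F>" "range (\<lambda>t. t *s x) \<subseteq> C"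
        using irreducible_in_finite_Union[OF zariski_irreducible_line F(1,2)] by blast
      have "0 *s x \<in> C" "1 *s x \<in> C" using C(2) by blast+
      then have "0 \<in> C" "x \<in> C" by simp_all
      moreover have "Z r \<subseteq> {0}" using ZY(1)[of r] r(2) 0 by auto
      ultimately show ?thesis using C(1) x(2) by blast
    next
      case (Suc r')
      have "Z r \<subseteq> \<Union>\<F>" using ZY(1)[of r] F(4) by (auto simp: Y_def)
      then obtain C where C: "C \<in> \<F>" "Z r \<subseteq> C"
        using irreducible_in_finite_Union[OF ZY(2) F(1,2)] by blast
      have "Z r' \<noteq> {}" "Z r' \<subset> Z r" using r(3) Suc by (auto simp: irreducible_chain_def zariski_irreducible_def)
      then have "\<not> C \<subseteq> {0}" using C(2) by blast
      then have "z C \<in> C" "z C \<notin> Y" using z[OF C(1)] m(2)[OF C(1)] by (auto simp: Y_def)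
      then show ?thesis using C ZY(1)[of r] by blast
    qed
    then obtain C where C: "C \<in> \<F>" "Z r \<subset> C" by blast
    have "irreducible_chain (Suc r) (Z(Suc r := C)) X"
      using r(3) C F(2,3)[OF C(1)] F(4) by (auto simp: irreducible_chain_def Y_def le_Suc_eq less_Suc_eq)
    then show ?thesis using forms zero by blast
  qed
qed

section \<open>Products\<close>

definition left_part :: "complex ^ ('m::finite + 'n::finite) \<Rightarrow> complex ^ 'm" where
  "left_part z = (\<chi> i. z $ Inl i)"

definition right_part :: "complex ^ ('m::finite + 'n::finite) \<Rightarrow> complex ^ 'n" where
  "right_part z = (\<chi> j. z $ Inr j)"

definition join_parts :: "complex ^ 'm \<Rightarrow> complex ^ 'n \<Rightarrow> complex ^ ('m::finite + 'n::finite)" where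
  "join_parts x y = (\<chi> s. case s of Inl i \<Rightarrow> x $ i | Inr j \<Rightarrow> y $ j)"

definition vec_product :: "(complex ^ 'm) set \<Rightarrow> (complex ^ 'n) set \<Rightarrow> (complex ^ ('m::finite + 'n::finite)) set" where
  "vec_product A B = {z. left_part z \<in> A \<and> right_part z \<in> B}"

lemma left_part_join [simp]: "left_part (join_parts x y) = x"
  and right_part_join [simp]: "right_part (join_parts x y) = y"
  by (simp_all add: left_part_def right_part_def join_parts_def)

lemma join_parts_parts [simp]: "join_parts (left_part z) (right_part z) = z"
  by (simp add: left_part_def right_part_def join_parts_def vec_eq_iff split: sum.split)

lemma left_part_scale: "left_part (t *s z) = t *s left_part z"
  and right_part_scale: "right_part (t *s z) = t *s right_part z"
  by (simp_all add: left_part_def right_part_def vec_eq_iff)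

lemma polynomial_fun_left_part: "polynomial_fun (\<lambda>z. left_part z $ i)"
  and polynomial_fun_right_part: "polynomial_fun (\<lambda>z. right_part z $ j)"
  by (simp_all add: left_part_def right_part_def polynomial_fun.coord)

lemma polynomial_fun_join_left: "polynomial_fun (\<lambda>x. join_parts x y $ s)"
  and polynomial_fun_join_right: "polynomial_fun (\<lambda>y. join_parts x y $ s)"
  by (cases s; simp add: join_parts_def polynomial_fun.intros)+

lemma zariski_closed_vimage:
  fixes \<phi> :: "complex ^ 'm \<Rightarrow> complex ^ 'n"
  assumes A: "zariski_closed A" and "\<And>i. polynomial_fun (\<lambda>x. \<phi> x $ i)"
  shows "zariski_closed {x. \<phi> x \<in> A}"
proof (rule zariski_closedI)
  fix y assume "y \<notin> {x. \<phi> x \<in> A}"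
  then obtain p where "polynomial_fun p" "\<And>x. x \<in> A \<Longrightarrow> p x = 0" "p (\<phi> y) \<noteq> 0"
    using zariski_closedE[OF A, of "\<phi> y"] by auto
  then show "\<exists>p. polynomial_fun p \<and> (\<forall>x\<in>{x. \<phi> x \<in> A}. p x = 0) \<and> p y \<noteq> 0"
    using polynomial_fun_compose[of p \<phi>] assms(2) by (intro exI[of _ "\<lambda>x. p (\<phi> x)"]) auto
qed

lemma zariski_closed_vec_product:
  assumes "zariski_closed A" "zariski_closed B"
  shows "zariski_closed (vec_product A B)"
proof -
  have "vec_product A B = {z. left_part z \<in> A} \<inter> {z. right_part z \<in> B}"
    by (auto simp: vec_product_def)
  then show ?thesis
    by (simp only:) (intro zariski_closed_Int zariski_closed_vimage assms
        polynomial_fun_left_part polynomial_fun_right_part)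
qed

text \<open>Slicing: each slice \<open>A \<times> {b}\<close> lies in one of two given closed sets \<open>U\<close>, \<open>V\<close> covering the
  product, and for each of \<open>U\<close> and \<open>V\<close> the points \<open>b\<close> whose slice lies in it form a closed set.\<close>

lemma zariski_irreducible_vec_product:
  assumes A: "zariski_irreducible A" and B: "zariski_irreducible B"
  shows "zariski_irreducible (vec_product A B)"
  unfolding zariski_irreducible_def
proof (intro conjI allI impI)
  obtain a b where "a \<in> A" "b \<in> B" using A B by (auto simp: zariski_irreducible_def)
  then have "join_parts a b \<in> vec_product A B" by (simp add: vec_product_def)
  then show "vec_product A B \<noteq> {}" by blast
next
  fix U V assume U: "zariski_closed U" and V: "zariski_closed V" and sub: "vec_product A B \<subseteq> U \<union> V"
  define S where "S W = (\<Inter>a\<in>A. {b. join_parts a b \<in> W})" for W :: "(complex ^ ('a + 'b)) set"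
  have closed: "zariski_closed (S W)" if "zariski_closed W" for W
    unfolding S_def using zariski_closed_vimage[OF that polynomial_fun_join_right]
    by (intro zariski_closed_Inter) auto
  have "B \<subseteq> S U \<union> S V"
  proof
    fix b assume b: "b \<in> B"
    have "A \<subseteq> {a. join_parts a b \<in> U} \<union> {a. join_parts a b \<in> V}"
    proof
      fix a assume "a \<in> A"
      then have "join_parts a b \<in> vec_product A B" using b by (simp add: vec_product_def)
      then show "a \<in> {a. join_parts a b \<in> U} \<union> {a. join_parts a b \<in> V}" using sub by blast
    qed
    then have "A \<subseteq> {a. join_parts a b \<in> U} \<or> A \<subseteq> {a. join_parts a b \<in> V}"
      using A zariski_closed_vimage[OF U polynomial_fun_join_left]
        zariski_closed_vimage[OF V polynomial_fun_join_left]
      unfolding zariski_irreducible_def by blast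
    then show "b \<in> S U \<union> S V" by (auto simp: S_def)
  qed
  then have "B \<subseteq> S U \<or> B \<subseteq> S V"
    using B closed[OF U] closed[OF V] unfolding zariski_irreducible_def by blast
  moreover have "vec_product A B \<subseteq> W" if "B \<subseteq> S W" for W
  proof
    fix z assume "z \<in> vec_product A B"
    then have "join_parts (left_part z) (right_part z) \<in> W"
      using that by (auto simp only: vec_product_def S_def)
    then show "z \<in> W" by simp
  qed
  ultimately show "vec_product A B \<subseteq> U \<or> vec_product A B \<subseteq> V" by blast
qed

lemma vec_product_mono: "A \<subseteq> A' \<Longrightarrow> B \<subseteq> B' \<Longrightarrow> vec_product A B \<subseteq> vec_product A' B'"
  by (auto simp: vec_product_def)

lemma vec_product_strict_mono:
  assumes "A \<subseteq> A'" "B \<subseteq> B'" "A \<noteq> {}" "B \<noteq> {}" "A \<subset> A' \<or> B \<subset> B'"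
  shows "vec_product A B \<subset> vec_product A' B'"
proof -
  obtain a b where "a \<in> A'" "b \<in> B'" "a \<notin> A \<or> b \<notin> B" using assms by blast
  then have "join_parts a b \<in> vec_product A' B'" "join_parts a b \<notin> vec_product A B"
    by (auto simp: vec_product_def)
  then show ?thesis using vec_product_mono[OF assms(1,2)] by blast
qed

text \<open>First the left factor climbs from \<open>Z 0\<close> to \<open>Z r\<close> with the right one fixed at \<open>W 0\<close>, then the
  right factor climbs with the left one fixed at \<open>Z r\<close>.\<close>

lemma irreducible_chain_vec_product:
  assumes Z: "irreducible_chain r Z X" and W: "irreducible_chain q W Y"
  shows "irreducible_chain (r + q) (\<lambda>i. if i \<le> r then vec_product (Z i) (W 0) else vec_product (Z r) (W (i - r)))
    (vec_product X Y)" (is "irreducible_chain _ ?V _")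
  unfolding irreducible_chain_def
proof (intro conjI allI impI)
  have ZW: "zariski_closed (Z i)" "zariski_irreducible (Z i)" "Z i \<subseteq> X" if "i \<le> r" for i
    using Z that by (auto simp: irreducible_chain_def)
  have W': "zariski_closed (W i)" "zariski_irreducible (W i)" "W i \<subseteq> Y" if "i \<le> q" for i
    using W that by (auto simp: irreducible_chain_def)
  show "zariski_closed (?V i)" "zariski_irreducible (?V i)" "?V i \<subseteq> vec_product X Y" if i: "i \<le> r + q" for i
  proof -
    obtain a b where "?V i = vec_product (Z a) (W b)" "a \<le> r" "b \<le> q"
    proof (cases "i \<le> r")
      case True
      then show ?thesis using that[of i 0] by simp
    next
      case False
      then show ?thesis using that[of r "i - r"] i by simp
    qed
    then show "zariski_closed (?V i)" "zariski_irreducible (?V i)" "?V i \<subseteq> vec_product X Y"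
      using zariski_closed_vec_product[OF ZW(1) W'(1)] zariski_irreducible_vec_product[OF ZW(2) W'(2)]
        vec_product_mono[OF ZW(3) W'(3)] by simp_all
  qed
  have ne: "Z i \<noteq> {}" if "i \<le> r" for i using ZW(2)[OF that] by (auto simp: zariski_irreducible_def)
  have ne': "W i \<noteq> {}" if "i \<le> q" for i using W'(2)[OF that] by (auto simp: zariski_irreducible_def)
  fix i assume i: "i < r + q"
  show "?V i \<subset> ?V (Suc i)"
  proof (cases "i < r")
    case True
    then have "Z i \<subset> Z (Suc i)" using Z by (auto simp: irreducible_chain_def)
    then have "vec_product (Z i) (W 0) \<subset> vec_product (Z (Suc i)) (W 0)"
      using ne[of i] ne'[of 0] True by (intro vec_product_strict_mono) auto
    then show ?thesis using True by simp
  next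
    case False
    define j where "j = i - r"
    have j: "j < q" "i = r + j" using False i by (auto simp: j_def)
    have "W j \<subset> W (Suc j)" using W j by (auto simp: irreducible_chain_def)
    then have "vec_product (Z r) (W j) \<subset> vec_product (Z r) (W (Suc j))"
      using ne[of r] ne'[of j] j by (intro vec_product_strict_mono) auto
    then show ?thesis using j by (cases "j = 0") (auto simp: Suc_diff_le)
  qed
qed

section \<open>The dimension of a product of cones\<close>

lemma alg_dim_eqI:
  assumes "irreducible_chain r Z X" "\<And>k Z. irreducible_chain k Z X \<Longrightarrow> k \<le> r"
  shows "alg_dim X = enat r"
proof -
  have "alg_dim X = Sup {enat k | k. \<exists>Z. irreducible_chain k Z X}"
    by (simp add: alg_dim_def irreducible_chain_def)
  also have "\<dots> = enat r"
    using assms by (intro antisym Sup_least Sup_upper) auto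
  finally show ?thesis .
qed

text \<open>The coordinates are \<open>CARD('n)\<close> linear forms whose only common zero is the origin.\<close>

lemma irreducible_chain_le_card:
  assumes "zariski_closed X" "complex_cone X" "irreducible_chain k Z (X :: (complex ^ 'n) set)"
  shows "k \<le> CARD('n)"
proof -
  obtain h :: "nat \<Rightarrow> 'n" where h: "bij_betw h {0..<CARD('n)} UNIV"
    using ex_bij_betw_nat_finite[OF finite, of "UNIV :: 'n set"] by blast
  show ?thesis
  proof (rule irreducible_chain_le_forms[OF assms(1,2) _ _ assms(3)])
    show "\<forall>k<CARD('n). linear_form (\<lambda>x :: complex ^ 'n. x $ h k)"
      by (simp add: linear_form_def polynomial_fun.coord)
    have "x = 0" if "\<forall>k<CARD('n). x $ h k = 0" for x :: "complex ^ 'n"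
    proof -
      have "x $ i = 0" for i
      proof -
        have "i \<in> h ` {0..<CARD('n)}" using h by (simp add: bij_betw_def)
        then show ?thesis using that by auto
      qed
      then show ?thesis by (simp add: vec_eq_iff)
    qed
    then show "\<forall>x\<in>X. (\<forall>k<CARD('n). x $ h k = 0) \<longrightarrow> x = 0" by blast
  qed
qed

text \<open>Forms and chain of \<open>cone_forms_and_chain\<close> have the same number \<open>r\<close>, so \<open>r\<close> is the dimension.
  Both kinds of data are inherited by products, with the numbers added.\<close>

theorem alg_codim_vec_product:
  fixes X :: "(complex ^ 'm) set" and Y :: "(complex ^ 'n) set"
  assumes X: "zariski_closed X" "complex_cone X" "0 \<in> X" and Y: "zariski_closed Y" "complex_cone Y" "0 \<in> Y"
  shows "alg_codim (vec_product X Y) = alg_codim X + alg_codim Y"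
proof -
  obtain r l Z where l: "\<forall>k<r. linear_form (l k)" "\<forall>x\<in>X. (\<forall>k<r. l k x = 0) \<longrightarrow> x = 0"
    and Z: "irreducible_chain r Z X" using cone_forms_and_chain[OF X] by blast
  obtain q m W where m: "\<forall>k<q. linear_form (m k)" "\<forall>y\<in>Y. (\<forall>k<q. m k y = 0) \<longrightarrow> y = 0"
    and W: "irreducible_chain q W Y" using cone_forms_and_chain[OF Y] by blast
  define u where "u k z = (if k < r then l k (left_part z) else m (k - r) (right_part z))"
    for k and z :: "complex ^ ('m + 'n)"
  have "linear_form (u k)" if k: "k < r + q" for k
  proof (cases "k < r")
    case True
    then have "linear_form (l k)" "u k = (\<lambda>z. l k (left_part z))" using l(1) by (auto simp: u_def)
    then show ?thesis
      by (auto simp: linear_form_def left_part_scale intro!: polynomial_fun_compose polynomial_fun_left_part)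
  next
    case False
    then have "linear_form (m (k - r))" "u k = (\<lambda>z. m (k - r) (right_part z))" using m(1) k by (auto simp: u_def)
    then show ?thesis
      by (auto simp: linear_form_def right_part_scale intro!: polynomial_fun_compose polynomial_fun_right_part)
  qed
  then have u: "\<forall>k<r + q. linear_form (u k)" by blast
  have u0: "\<forall>z\<in>vec_product X Y. (\<forall>k<r + q. u k z = 0) \<longrightarrow> z = 0"
  proof (intro ballI impI)
    fix z assume z: "z \<in> vec_product X Y" and zero: "\<forall>k<r + q. u k z = 0"
    have "l k (left_part z) = 0" if "k < r" for k using zero[rule_format, of k] that by (simp add: u_def)
    moreover have "m k (right_part z) = 0" if "k < q" for k
      using zero[rule_format, of "r + k"] that by (simp add: u_def)
    ultimately have "left_part z = 0" "right_part z = 0" using z l(2) m(2) by (auto simp: vec_product_def)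
    then have "z = join_parts 0 0" by (metis join_parts_parts)
    then show "z = 0" by (simp add: join_parts_def vec_eq_iff split: sum.split)
  qed
  have XY: "zariski_closed (vec_product X Y)" "complex_cone (vec_product X Y)"
    using zariski_closed_vec_product[OF X(1) Y(1)] X(2) Y(2)
    by (simp_all add: complex_cone_def vec_product_def left_part_scale right_part_scale)
  have "alg_dim X = enat r"
    using Z irreducible_chain_le_forms[OF X(1,2) l] by (rule alg_dim_eqI)
  moreover have "alg_dim Y = enat q"
    using W irreducible_chain_le_forms[OF Y(1,2) m] by (rule alg_dim_eqI)
  moreover have "alg_dim (vec_product X Y) = enat (r + q)"
    using irreducible_chain_vec_product[OF Z W] irreducible_chain_le_forms[OF XY u u0] by (rule alg_dim_eqI)
  moreover have "r \<le> CARD('m)" "q \<le> CARD('n)"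
    using irreducible_chain_le_card X Y Z W by blast+
  ultimately show ?thesis by (simp add: alg_codim_def)
qed


section \<open>The singular locus of a form\<close>

definition replace_coord :: "complex ^ 'n \<Rightarrow> 'n \<Rightarrow> complex \<Rightarrow> complex ^ 'n" where
  "replace_coord x i z = (\<chi> j. if j = i then z else x $ j)"

lemma partial_deriv_eq: "partial_deriv i F x = deriv (\<lambda>z. F (replace_coord x i z)) (x $ i)"
  by (simp add: partial_deriv_def replace_coord_def)

lemma replace_coord_same [simp]: "replace_coord x i (x $ i) = x"
  by (simp add: replace_coord_def vec_eq_iff)

lemma field_differentiable_replace_coord:
  assumes "polynomial_fun F"
  shows "(\<lambda>z. F (replace_coord x i z)) field_differentiable at a"
  using assms
proof (induction rule: polynomial_fun.induct)
  case (coord j)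
  then show ?case by (cases "j = i") (auto simp: replace_coord_def)
qed (auto intro: field_differentiable_add field_differentiable_mult)

lemma polynomial_fun_partial_deriv:
  assumes "polynomial_fun F"
  shows "polynomial_fun (partial_deriv i F)"
  using assms
proof (induction rule: polynomial_fun.induct)
  case (const c)
  then show ?case by (simp add: partial_deriv_eq[abs_def] polynomial_fun.const)
next
  case (coord j)
  show ?case
    by (cases "j = i") (simp_all add: partial_deriv_eq[abs_def] replace_coord_def polynomial_fun.const)
next
  case (add f g)
  then have "partial_deriv i (\<lambda>x. f x + g x) = (\<lambda>x. partial_deriv i f x + partial_deriv i g x)"
    by (simp add: fun_eq_iff partial_deriv_eq field_differentiable_replace_coord)
  then show ?case using add by (simp add: polynomial_fun.add)
next
  case (mult f g)
  then have "partial_deriv i (\<lambda>x. f x * g x) =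
      (\<lambda>x. f x * partial_deriv i g x + partial_deriv i f x * g x)"
    by (simp add: fun_eq_iff partial_deriv_eq field_differentiable_replace_coord)
  then show ?case using mult by (simp add: polynomial_fun.intros)
qed

lemma assoc_poly_monom: "assoc_poly d T x = (\<Sum>xs | length xs = d. T xs * monom_fun xs x)"
  by (simp add: assoc_poly_def monom_fun_def)

lemma polynomial_fun_assoc_poly: "polynomial_fun (assoc_poly d T)"
  unfolding assoc_poly_monom[abs_def] by (intro polynomial_fun_intros polynomial_fun_monom)

lemma assoc_poly_scale: "assoc_poly d T (t *s x) = t ^ d * assoc_poly d T x"
  by (simp add: assoc_poly_monom monom_fun_scale sum_distrib_left mult_ac)

definition singular_locus :: "nat \<Rightarrow> ('n::finite list \<Rightarrow> complex) \<Rightarrow> (complex ^ 'n) set" where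
  "singular_locus d T = {x. \<forall>i. partial_deriv i (assoc_poly d T) x = 0}"

lemma zariski_closed_singular_locus: "zariski_closed (singular_locus d T)"
proof -
  have "singular_locus d T = (\<Inter>i. {x. partial_deriv i (assoc_poly d T) x = 0})"
    by (auto simp: singular_locus_def)
  also have "zariski_closed \<dots>"
    by (intro zariski_closed_Inter)
      (auto intro: zariski_closed_zeros polynomial_fun_partial_deriv polynomial_fun_assoc_poly)
  finally show ?thesis .
qed

text \<open>Along the \<open>i\<close>-th coordinate axis the form is a multiple of \<open>z ^ d\<close>, with vanishing derivative at \<open>0\<close>
  because \<open>d \<ge> 2\<close>.\<close>

lemma zero_in_singular_locus:
  assumes "d \<ge> 2"
  shows "0 \<in> singular_locus d T"
proof -
  have "partial_deriv i (assoc_poly d T) 0 = 0" for i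
  proof -
    have "replace_coord 0 i z = z *s axis i 1" for z
      by (simp add: replace_coord_def vec_eq_iff axis_def)
    then have "partial_deriv i (assoc_poly d T) 0 = deriv (\<lambda>z. z ^ d * assoc_poly d T (axis i 1)) 0"
      by (simp add: partial_deriv_eq assoc_poly_scale)
    also have "\<dots> = 0"
      by (rule DERIV_imp_deriv) (use assms in \<open>auto intro!: derivative_eq_intros\<close>)
    finally show ?thesis .
  qed
  then show ?thesis by (simp add: singular_locus_def)
qed

text \<open>The partial derivatives are homogeneous: for \<open>t \<noteq> 0\<close>, differentiate \<open>F (t x) = t\<^sup>d F x\<close> along a
  coordinate direction.  The case \<open>t = 0\<close> is the previous lemma.\<close>

lemma cone_singular_locus:
  fixes T :: "'n::finite list \<Rightarrow> complex"
  assumes "d \<ge> 2"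
  shows "complex_cone (singular_locus d T)"
  unfolding complex_cone_def
proof (intro ballI allI)
  fix x :: "complex ^ 'n" and t assume x: "x \<in> singular_locus d T"
  show "t *s x \<in> singular_locus d T"
  proof (cases "t = 0")
    case True
    then show ?thesis using zero_in_singular_locus[OF assms] by simp
  next
    case False
    have "partial_deriv i (assoc_poly d T) (t *s x) = 0" for i
    proof -
      define G where "G = (\<lambda>z. assoc_poly d T (replace_coord x i z))"
      have "deriv G (x $ i) = 0" using x by (simp add: singular_locus_def partial_deriv_eq G_def)
      moreover have "G field_differentiable at (x $ i)"
        unfolding G_def by (rule field_differentiable_replace_coord[OF polynomial_fun_assoc_poly])
      ultimately have "(G has_field_derivative 0) (at (x $ i))"
        by (metis field_differentiable_derivI)
      then have "(G has_field_derivative 0) (at (t * x $ i / t))" using False by simp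
      then have "((\<lambda>z. G (z / t)) has_field_derivative 0 * (1 / t)) (at (t * x $ i))"
        by (rule DERIV_chain2) (use False in \<open>auto intro!: derivative_eq_intros\<close>)
      then have "((\<lambda>z. t ^ d * G (z / t)) has_field_derivative t ^ d * (0 * (1 / t))) (at (t * x $ i))"
        by (rule DERIV_cmult)
      moreover have "assoc_poly d T (replace_coord (t *s x) i z) = t ^ d * G (z / t)" for z
      proof -
        have "replace_coord (t *s x) i z = t *s replace_coord x i (z / t)"
          using False by (simp add: replace_coord_def vec_eq_iff)
        then show ?thesis by (simp add: assoc_poly_scale G_def)
      qed
      ultimately show ?thesis by (simp add: partial_deriv_eq DERIV_imp_deriv)
    qed
    then show ?thesis by (simp add: singular_locus_def)
  qed
qed

lemma singular_locus_tensor_sum: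
  fixes S :: "'m::finite list \<Rightarrow> complex" and T :: "'n::finite list \<Rightarrow> complex"
  assumes "d > 0"
  shows "singular_locus d (S \<oplus>\<^sub>t T) = vec_product (singular_locus d S) (singular_locus d T)"
proof -
  let ?F = "assoc_poly d (S \<oplus>\<^sub>t T)"
  have F: "?F = (\<lambda>z. assoc_poly d S (left_part z) + assoc_poly d T (right_part z))"
    unfolding left_part_def right_part_def by (rule ext) (rule assoc_poly_tensor_sum[OF assms])
  note diff = field_differentiable_replace_coord[OF polynomial_fun_assoc_poly]
  have left: "partial_deriv (Inl i) ?F z = partial_deriv i (assoc_poly d S) (left_part z)" for i z
  proof -
    have "left_part (replace_coord z (Inl i) w) = replace_coord (left_part z) i w"
      "right_part (replace_coord z (Inl i) w) = right_part z" for w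
      by (simp_all add: left_part_def right_part_def replace_coord_def vec_eq_iff)
    moreover have "z $ Inl i = left_part z $ i" by (simp add: left_part_def)
    ultimately show ?thesis unfolding partial_deriv_eq F by (simp add: diff)
  qed
  have right: "partial_deriv (Inr j) ?F z = partial_deriv j (assoc_poly d T) (right_part z)" for j z
  proof -
    have "left_part (replace_coord z (Inr j) w) = left_part z"
      "right_part (replace_coord z (Inr j) w) = replace_coord (right_part z) j w" for w
      by (simp_all add: left_part_def right_part_def replace_coord_def vec_eq_iff)
    moreover have "z $ Inr j = right_part z $ j" by (simp add: right_part_def)
    ultimately show ?thesis unfolding partial_deriv_eq F by (simp add: diff)
  qed
  have "(\<forall>s. partial_deriv s ?F z = 0) \<longleftrightarrow>
      (\<forall>i. partial_deriv (Inl i) ?F z = 0) \<and> (\<forall>j. partial_deriv (Inr j) ?F z = 0)" for z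
    by (metis sum.exhaust)
  then show ?thesis by (auto simp: singular_locus_def vec_product_def left right)
qed

theorem lemma3p2:
  fixes d :: nat and T1 T2 :: "'n::finite list \<Rightarrow> complex"
  assumes "d \<ge> 2"
    and "T1 \<in> sym_tensors d" and "T2 \<in> sym_tensors d"
  shows "sgr d (T1 \<oplus>\<^sub>t T2) = sgr d T1 + sgr d T2"
proof -
  have "singular_locus d (T1 \<oplus>\<^sub>t T2) = vec_product (singular_locus d T1) (singular_locus d T2)"
    using assms(1) by (intro singular_locus_tensor_sum) auto
  then show ?thesis
    using alg_codim_vec_product[OF zariski_closed_singular_locus cone_singular_locus zero_in_singular_locus
        zariski_closed_singular_locus cone_singular_locus zero_in_singular_locus, OF assms(1) assms(1) assms(1) assms(1), of T1 T2]
    by (simp add: sgr_def singular_locus_def)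
qed

end
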